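(* For every $0<\delta\leqslant 1$ and every integer $k\geqslant 2$ there exist $\theta>0$ and an integer $q_0\geqslant k$ with the following property. Let $n\geqslant q_0$ be an integer and let $\mathcal{A}\subseteq\{0,1\}^{\binom{[n]}{2}}$ be a $\theta$-quasirandom family of graphs with $\mu(\mathcal{A})\geqslant\delta$. Then there exist $K\subseteq[n]$ with $|K|=k$ and $W\subseteq\binom{[n]}{2}\setminus\binom{K}{2}$ such that \[ \{W\}\cup\Big\{W\cup\{e\}:e\in\binom{K}{2}\Big\}\subseteq\mathcal{A}. \] In particular, there exist $G,H\in\mathcal{A}$ with $H\subseteq G$ such that $G\setminus H=\binom{X}{2}$ for some $X\subseteq[n]$ with $|X|\geqslant 2$.
   Context: A graph on $[n]=\{1,\dots,n\}$ is identified with a subset of $\binom{[n]}{2}$ (the set of 2-element subsets of $[n]$), and subsets of a finite index set $I$ are identified with elements of $\{0,1\}^I$ via indicator functions. $\mu$ is the uniform probability measure on $\{0,1\}^{\binom{[n]}{2}}$. For $\theta>0$, a family $\mathcal{A}\subseteq\{0,1\}^{\binom{[n]}{2}}$ is $\theta$-quasirandom if there exists $\mathcal{U}\subseteq\binom{[n]}{4}$ with $|\mathcal{U}|\geqslant(1-\theta)\binom{n}{4}$ such that for every $U=\{i<j<k<\ell\}\in\mathcal{U}$, \[ \mathbf{P}\big(W:\ W\cup\{\{i,k\}\},\,W\cup\{\{i,\ell\}\},\,W\cup\{\{j,k\}\},\,W\cup\{\{j,\ell\}\}\in\mathcal{A}\big)\leqslant\mu(\mathcal{A})^4+\theta, \]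 where $\mathbf{P}$ is the uniform probability measure on subsets $W$ of $\binom{[n]}{2}\setminus\binom{U}{2}$. *)

theory Defs
  imports Complex_Main
begin

definition pairs :: "nat set \<Rightarrow> nat set set" where
  "pairs S = {e. e \<subseteq> S \<and> card e = 2}"

definition quads :: "nat set \<Rightarrow> nat set set" where
  "quads S = {U. U \<subseteq> S \<and> card U = 4}"

definition edges :: "nat \<Rightarrow> nat set set" where
  "edges n = pairs {1..n}"

definition mu :: "nat \<Rightarrow> nat set set set \<Rightarrow> real" where
  "mu n A = real (card (A \<inter> Pow (edges n))) / 2 ^ card (edges n)"

definition box_prob :: "nat \<Rightarrow> nat set set set \<Rightarrow> nat \<Rightarrow> nat \<Rightarrow> nat \<Rightarrow> nat \<Rightarrow> real" where
  "box_prob n A i j k l =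
     (let D = edges n - pairs {i, j, k, l} in
      real (card {W. W \<subseteq> D \<and> insert {i,k} W \<in> A \<and> insert {i,l} W \<in> A
                        \<and> insert {j,k} W \<in> A \<and> insert {j,l} W \<in> A}) / 2 ^ card D)"

definition quasirandom :: "real \<Rightarrow> nat \<Rightarrow> nat set set set \<Rightarrow> bool" where
  "quasirandom \<theta> n A \<longleftrightarrow>
     (\<exists>\<U> \<subseteq> quads {1..n}.
        real (card \<U>) \<ge> (1 - \<theta>) * real (n choose 4) \<and>
        (\<forall>i j k l. {i, j, k, l} \<in> \<U> \<longrightarrow> i < j \<longrightarrow> j < k \<longrightarrow> k < l \<longrightarrow>
            box_prob n A i j k l \<le> mu n A ^ 4 + \<theta>))"

end

theory Submission
  imports Defs "HOL-Library.FuncSet" "HOL-Library.Indicator_Function"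
begin

text \<open>Cut \<open>[n]\<close> into \<open>q = k m\<close> consecutive intervals, pick a random vertex \<open>x p\<close> in each, and let \<open>W\<close> be
  a random graph with all pairs of chosen vertices erased. As \<open>q\<close> is bounded while \<open>n\<close> is large,
  the law of \<open>W\<close> is close in total variation to the uniform one, even when conditioned on
  boundedly many chosen vertices. Hence in the random graph on \<open>{0..<q}\<close> joining \<open>p\<close> and \<open>r\<close>
  when \<open>W \<union> {{x p, x r}} \<in> A\<close>, every pair has density about \<open>\<mu>\<close>, and quasirandomness bounds
  the expected four-cycle density between two blocks of \<open>m\<close> vertices by about \<open>\<mu>\<^sup>4\<close>. So with
  probability close to \<open>1\<close> all pairs of blocks are quasirandom in the sense of Chung, Graham and
  Wilson; in particular this happens together with \<open>W \<in> A\<close>, which has probability about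
  \<open>\<mu> \<ge> \<delta>\<close>. Choosing one vertex from each block greedily then gives a clique on \<open>k\<close> vertices.\<close>

section \<open>Averages over finite sets\<close>

text \<open>Expectation under the uniform distribution on \<open>S\<close>. For empty or infinite
  \<open>S\<close> the value is 0, so linearity and monotonicity hold unconditionally and only
  comparisons with constants ask for a finite nonempty \<open>S\<close>.\<close>

definition avg :: "'a set \<Rightarrow> ('a \<Rightarrow> real) \<Rightarrow> real" where
  "avg S f = (\<Sum>s\<in>S. f s) / real (card S)"

lemma avg_cong: "(\<And>s. s \<in> S \<Longrightarrow> f s = g s) \<Longrightarrow> avg S f = avg S g"
  unfolding avg_def by (metis sum.cong)

lemma avg_add: "avg S (\<lambda>s. f s + g s) = avg S f + avg S g"
  by (simp add: avg_def sum.distrib add_divide_distrib)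

lemma avg_diff: "avg S (\<lambda>s. f s - g s) = avg S f - avg S g"
  by (simp add: avg_def sum_subtractf diff_divide_distrib)

lemma avg_cmult: "avg S (\<lambda>s. c * f s) = c * avg S f"
  by (simp add: avg_def sum_distrib_left)

lemma avg_multc: "avg S (\<lambda>s. f s * c) = avg S f * c"
  by (simp add: avg_def sum_distrib_right)

lemma avg_const: "finite S \<Longrightarrow> S \<noteq> {} \<Longrightarrow> avg S (\<lambda>s. c) = c"
  by (simp add: avg_def)

lemma avg_mono: "(\<And>s. s \<in> S \<Longrightarrow> f s \<le> g s) \<Longrightarrow> avg S f \<le> avg S g"
  unfolding avg_def by (intro divide_right_mono sum_mono) auto

lemma avg_nonneg: "(\<And>s. s \<in> S \<Longrightarrow> 0 \<le> f s) \<Longrightarrow> 0 \<le> avg S f"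
  unfolding avg_def by (intro divide_nonneg_nonneg sum_nonneg) auto

lemma avg_le_const:
  assumes "finite S" "S \<noteq> {}" "\<And>s. s \<in> S \<Longrightarrow> f s \<le> c"
  shows "avg S f \<le> c"
  using avg_mono[of S f "\<lambda>_. c"] assms by (simp add: avg_const)

lemma avg_ge_const:
  assumes "finite S" "S \<noteq> {}" "\<And>s. s \<in> S \<Longrightarrow> c \<le> f s"
  shows "c \<le> avg S f"
  using avg_mono[of S "\<lambda>_. c" f] assms by (simp add: avg_const)

lemma avg_swap: "avg S (\<lambda>s. avg T (\<lambda>t. f s t)) = avg T (\<lambda>t. avg S (\<lambda>s. f s t))"
  unfolding avg_def sum_divide_distrib[symmetric]
  by (subst sum.swap) (simp add: mult.commute)

lemma avg_abs: "\<bar>avg S f\<bar> \<le> avg S (\<lambda>s. \<bar>f s\<bar>)"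
  unfolding avg_def by (simp add: abs_divide divide_right_mono)

lemma avg_sum: "avg S (\<lambda>s. \<Sum>i\<in>I. f i s) = (\<Sum>i\<in>I. avg S (f i))"
  unfolding avg_def by (subst sum.swap) (simp add: sum_divide_distrib)

lemma avg_mult_avg: "avg S f * avg T g = avg S (\<lambda>s. avg T (\<lambda>t. f s * g t))"
  by (simp add: avg_cmult avg_multc)

lemma avg_square_le:
  assumes "finite S" "S \<noteq> {}"
  shows "(avg S f)\<^sup>2 \<le> avg S (\<lambda>s. (f s)\<^sup>2)"
proof -
  define a where "a = avg S f"
  have "0 \<le> avg S (\<lambda>s. (f s - a)\<^sup>2)" by (rule avg_nonneg) simp
  also have "\<dots> = avg S (\<lambda>s. (f s)\<^sup>2 - 2 * a * f s + a\<^sup>2)"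
    by (rule avg_cong) (simp add: power2_eq_square algebra_simps)
  also have "\<dots> = avg S (\<lambda>s. (f s)\<^sup>2) - a\<^sup>2"
    using assms by (simp add: avg_add avg_diff avg_cmult avg_const a_def power2_eq_square)
  finally show ?thesis by (simp add: a_def)
qed

lemma avg_abs_le_sqrt:
  assumes "finite S" "S \<noteq> {}"
  shows "avg S (\<lambda>s. \<bar>f s\<bar>) \<le> sqrt (avg S (\<lambda>s. (f s)\<^sup>2))"
  using avg_square_le[OF assms, of "\<lambda>s. \<bar>f s\<bar>"] by (simp add: real_le_rsqrt)

section \<open>Random sets overridden on small blocks\<close>

text \<open>A set with trace \<open>T\<close> on \<open>B\<close> results from overriding exactly
  \<open>2 ^ card B\<close> sets, one for each trace that was overwritten.\<close>

lemma sum_Pow_override: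
  fixes F :: "'a set \<Rightarrow> real"
  assumes "finite E" "B \<subseteq> E" "T \<subseteq> B"
  shows "(\<Sum>W\<in>Pow E. F ((W - B) \<union> T)) = 2 ^ card B * (\<Sum>W | W \<subseteq> E \<and> W \<inter> B = T. F W)"
proof -
  have fin: "finite B" "finite (Pow E)" "finite {W. W \<subseteq> E \<and> W \<inter> B = T}"
    using assms finite_subset by (auto intro: finite_subset[of _ "Pow E"])
  have "2 ^ card B * (\<Sum>W | W \<subseteq> E \<and> W \<inter> B = T. F W)
      = (\<Sum>(X, W)\<in>Pow B \<times> {W. W \<subseteq> E \<and> W \<inter> B = T}. F W)"
    using fin by (simp add: sum.cartesian_product[symmetric] card_Pow)
  also have "\<dots> = (\<Sum>W\<in>Pow E. F ((W - B) \<union> T))"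
    by (rule sum.reindex_bij_witness[where i = "\<lambda>W. (W \<inter> B, (W - B) \<union> T)"
          and j = "\<lambda>(X, W). (W - B) \<union> X"])
       (use assms in \<open>auto intro!: arg_cong[where f=F]\<close>)
  finally show ?thesis by simp
qed

text \<open>Overriding a uniformly random set on one of many disjoint small blocks hardly changes its
  distribution: the density of the new law is the average of the pairwise uncorrelated weights
  \<open>Z i\<close> below, and its variance is at most \<open>2 ^ r / card I\<close>.\<close>

lemma avg_override_blocks:
  fixes F :: "'a set \<Rightarrow> real"
  assumes E: "finite E" and I: "finite I" "I \<noteq> {}"
    and B: "\<And>i. i \<in> I \<Longrightarrow> B i \<subseteq> E" "\<And>i. i \<in> I \<Longrightarrow> card (B i) \<le> r"
    and disj: "\<And>i j. i \<in> I \<Longrightarrow> j \<in> I \<Longrightarrow> i \<noteq> j \<Longrightarrow> B i \<inter> B j = {}"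
    and T: "\<And>i. i \<in> I \<Longrightarrow> T i \<subseteq> B i"
    and F: "\<And>W. 0 \<le> F W" "\<And>W. F W \<le> 1"
  shows "\<bar>avg I (\<lambda>i. avg (Pow E) (\<lambda>W. F ((W - B i) \<union> T i))) - avg (Pow E) F\<bar>
         \<le> sqrt (2 ^ r / card I)"
proof -
  define Z where "Z i W = (if W \<inter> B i = T i then 2 ^ card (B i) else 0 :: real)" for i W
  have P: "finite (Pow E)" "Pow E \<noteq> {}" using E by auto
  \<comment> \<open>Change of measure: \<open>Z i\<close> is the density, relative to the uniform
    law, of the random set overridden on block \<open>i\<close>.\<close>
  have change: "avg (Pow E) (\<lambda>W. G ((W - B i) \<union> T i)) = avg (Pow E) (\<lambda>W. Z i W * G W)"
    if "i \<in> I" for i and G :: "'a set \<Rightarrow> real"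
  proof -
    have "(\<Sum>W\<in>Pow E. Z i W * G W) = (\<Sum>W\<in>Pow E. if W \<inter> B i = T i then 2 ^ card (B i) * G W else 0)"
      by (rule sum.cong) (auto simp: Z_def)
    also have "\<dots> = 2 ^ card (B i) * (\<Sum>W | W \<subseteq> E \<and> W \<inter> B i = T i. G W)"
      using P by (simp add: sum.inter_filter[symmetric] sum_distrib_left)
    finally show ?thesis
      using sum_Pow_override[OF E B(1)[OF that] T[OF that], of G] by (simp add: avg_def)
  qed
  have Z1: "avg (Pow E) (Z i) = 1" if "i \<in> I" for i
    using change[OF that, of "\<lambda>_. 1"] P by (simp add: avg_const)
  \<comment> \<open>Overriding block \<open>i\<close> forces the trace \<open>T i\<close>, where
    \<open>Z i\<close> takes its maximum, and leaves the trace on any other block alone by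
    disjointness. So the mixed moments factor.\<close>
  have Zij: "avg (Pow E) (\<lambda>W. Z i W * Z j W) = (if i = j then 2 ^ card (B i) else 1)"
    if "i \<in> I" "j \<in> I" for i j
  proof -
    have "avg (Pow E) (\<lambda>W. Z i W * Z j W) = avg (Pow E) (\<lambda>W. Z j ((W - B i) \<union> T i))"
      using change[OF that(1), of "Z j"] by simp
    also have "\<dots> = (if i = j then 2 ^ card (B i) else 1)"
    proof (cases "i = j")
      case True
      have "Z j ((W - B i) \<union> T i) = 2 ^ card (B i)" for W
        using T[OF that(1)] True by (auto simp: Z_def)
      then show ?thesis using True P by (simp add: avg_const)
    next
      case False
      have "Z j ((W - B i) \<union> T i) = Z j W" for W
      proof -
        have "((W - B i) \<union> T i) \<inter> B j = W \<inter> B j"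
          using T[OF that(1)] disj[OF that False] by blast
        then show ?thesis by (simp add: Z_def)
      qed
      then show ?thesis using Z1[OF that(2)] False by simp
    qed
    finally show ?thesis .
  qed
  define D where "D W = avg I (\<lambda>i. Z i W) - 1" for W
  have "avg (Pow E) (\<lambda>W. (D W)\<^sup>2) = avg (Pow E) (\<lambda>W. avg I (\<lambda>i. avg I (\<lambda>j. Z i W * Z j W - Z i W - Z j W + 1)))"
    by (rule avg_cong)
       (simp add: D_def power2_eq_square avg_add avg_diff avg_cmult avg_multc avg_const I algebra_simps)
  also have "\<dots> = avg I (\<lambda>i. avg I (\<lambda>j. avg (Pow E) (\<lambda>W. Z i W * Z j W - Z i W - Z j W + 1)))"
    by (subst avg_swap, rule avg_cong, subst avg_swap, rule refl)
  also have "\<dots> = avg I (\<lambda>i. avg I (\<lambda>j. if i = j then 2 ^ card (B i) - 1 else 0))"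
    by (intro avg_cong) (simp add: avg_add avg_diff Zij Z1 avg_const P E)
  also have "\<dots> \<le> avg I (\<lambda>i. 2 ^ r / card I)"
  proof (rule avg_mono)
    fix i assume i: "i \<in> I"
    have "avg I (\<lambda>j. if i = j then 2 ^ card (B i) - 1 else (0::real)) = (2 ^ card (B i) - 1) / card I"
      using i I by (simp add: avg_def)
    also have "\<dots> \<le> 2 ^ r / card I"
    proof (rule divide_right_mono)
      have "(2::real) ^ card (B i) \<le> 2 ^ r" by (rule power_increasing[OF B(2)[OF i]]) simp
      then show "2 ^ card (B i) - 1 \<le> (2::real) ^ r" by linarith
    qed simp
    finally show "avg I (\<lambda>j. if i = j then 2 ^ card (B i) - 1 else (0::real)) \<le> 2 ^ r / card I" .
  qed
  finally have var: "avg (Pow E) (\<lambda>W. (D W)\<^sup>2) \<le> 2 ^ r / card I"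
    using I by (simp add: avg_const)
  \<comment> \<open>\<open>D\<close> is the deviation of the averaged density from 1. The two means
    of \<open>F\<close> differ by the mean of \<open>D W * F W\<close>; as \<open>F\<close> lies
    between 0 and 1, this is at most the first absolute moment of \<open>D\<close>, which the
    variance bounds.\<close>
  have "avg I (\<lambda>i. avg (Pow E) (\<lambda>W. F ((W - B i) \<union> T i))) = avg I (\<lambda>i. avg (Pow E) (\<lambda>W. Z i W * F W))"
    by (rule avg_cong) (rule change)
  also have "\<dots> = avg (Pow E) (\<lambda>W. avg I (\<lambda>i. Z i W) * F W)"
    by (subst avg_swap) (simp add: avg_multc)
  finally have "avg I (\<lambda>i. avg (Pow E) (\<lambda>W. F ((W - B i) \<union> T i))) - avg (Pow E) F
      = avg (Pow E) (\<lambda>W. D W * F W)"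
    by (simp add: D_def avg_diff[symmetric] algebra_simps)
  then have "\<bar>avg I (\<lambda>i. avg (Pow E) (\<lambda>W. F ((W - B i) \<union> T i))) - avg (Pow E) F\<bar>
      \<le> avg (Pow E) (\<lambda>W. \<bar>D W * F W\<bar>)"
    by (simp add: avg_abs)
  also have "\<dots> \<le> avg (Pow E) (\<lambda>W. \<bar>D W\<bar>)"
    using F by (intro avg_mono) (simp add: abs_mult mult_left_le)
  also have "\<dots> \<le> sqrt (avg (Pow E) (\<lambda>W. (D W)\<^sup>2))"
    by (rule avg_abs_le_sqrt[OF P])
  also have "\<dots> \<le> sqrt (2 ^ r / card I)"
    using var by simp
  finally show ?thesis .
qed

text \<open>Exchanging \<open>x r\<close> with the fresh value \<open>v\<close> is an involution, so
  redrawing coordinate \<open>r\<close> preserves the uniform law. This isolates one random vertex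
  while the others are held fixed.\<close>

lemma avg_PiE_resample:
  assumes "r \<in> J" "finite (V r)" "V r \<noteq> {}"
  shows "avg (PiE J V) (\<lambda>x. avg (V r) (\<lambda>v. g (x(r := v)))) = avg (PiE J V) g"
proof -
  have "(\<Sum>x\<in>PiE J V. \<Sum>v\<in>V r. g (x(r := v))) = (\<Sum>(x, v)\<in>PiE J V \<times> V r. g (x(r := v)))"
    by (rule sum.cartesian_product)
  also have "\<dots> = (\<Sum>(x, v)\<in>PiE J V \<times> V r. g x)"
    by (rule sum.reindex_bij_witness[where i = "\<lambda>(x, v). (x(r := v), x r)" and j = "\<lambda>(x, v). (x(r := v), x r)"])
       (use assms in \<open>auto simp: PiE_iff extensional_def\<close>)
  also have "\<dots> = real (card (V r)) * (\<Sum>x\<in>PiE J V. g x)"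
    by (simp add: sum.cartesian_product[symmetric] sum_distrib_left)
  finally show ?thesis
    using assms by (simp add: avg_def sum_divide_distrib[symmetric])
qed

section \<open>Degrees and codegrees in quasirandom bipartite graphs\<close>

text \<open>Second-moment form of the Chung--Graham--Wilson criterion, centred at a prescribed
  density \<open>p\<close>. The linear term makes the left-hand side suitable for averaging over random
  bipartite graphs \<open>f\<close>.\<close>

lemma C4_defect_identity:
  fixes f :: "'a \<Rightarrow> 'b \<Rightarrow> real"
  assumes X: "finite X" "X \<noteq> {}" and Y: "finite Y" "Y \<noteq> {}"
  shows "avg Y (\<lambda>y. avg Y (\<lambda>y'. (avg X (\<lambda>x. f x y * f x y'))\<^sup>2))
           - 4 * p ^ 3 * avg X (\<lambda>x. avg Y (f x)) + 3 * p ^ 4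
       = avg Y (\<lambda>y. avg Y (\<lambda>y'. (avg X (\<lambda>x. f x y * f x y') - p\<^sup>2)\<^sup>2))
           + 2 * p\<^sup>2 * avg X (\<lambda>x. (avg Y (f x) - p)\<^sup>2)"
proof -
  let ?c = "\<lambda>y y'. avg X (\<lambda>x. f x y * f x y')"
  \<comment> \<open>The mean codegree is the mean squared degree; hence its multiples by
    \<open>2 * p\<^sup>2\<close> in the two expansions below cancel.\<close>
  have cod: "avg Y (\<lambda>y. avg Y (?c y)) = avg X (\<lambda>x. (avg Y (f x))\<^sup>2)"
  proof -
    have "avg Y (\<lambda>y. avg Y (?c y)) = avg X (\<lambda>x. avg Y (\<lambda>y. avg Y (\<lambda>y'. f x y * f x y')))"
      by (subst avg_swap[of Y X, symmetric], rule avg_cong, rule avg_swap)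
    then show ?thesis by (simp add: power2_eq_square avg_mult_avg)
  qed
  have "avg Y (\<lambda>y. avg Y (\<lambda>y'. (?c y y' - p\<^sup>2)\<^sup>2))
      = avg Y (\<lambda>y. avg Y (\<lambda>y'. (?c y y')\<^sup>2 - 2 * p\<^sup>2 * ?c y y' + p ^ 4))"
    by (intro avg_cong) (simp add: power2_diff algebra_simps)
  also have "\<dots> = avg Y (\<lambda>y. avg Y (\<lambda>y'. (?c y y')\<^sup>2)) - 2 * p\<^sup>2 * avg X (\<lambda>x. (avg Y (f x))\<^sup>2) + p ^ 4"
    using Y cod by (simp add: avg_add avg_diff avg_cmult avg_const)
  finally have 1: "avg Y (\<lambda>y. avg Y (\<lambda>y'. (?c y y' - p\<^sup>2)\<^sup>2)) = \<dots>" .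
  have "avg X (\<lambda>x. (avg Y (f x) - p)\<^sup>2) = avg X (\<lambda>x. (avg Y (f x))\<^sup>2 - 2 * p * avg Y (f x) + p\<^sup>2)"
    by (intro avg_cong) (simp add: power2_diff algebra_simps)
  also have "\<dots> = avg X (\<lambda>x. (avg Y (f x))\<^sup>2) - 2 * p * avg X (\<lambda>x. avg Y (f x)) + p\<^sup>2"
    using X by (simp add: avg_add avg_diff avg_cmult avg_const)
  finally have 2: "avg X (\<lambda>x. (avg Y (f x) - p)\<^sup>2) = \<dots>" .
  show ?thesis unfolding 1 2
    by (simp add: algebra_simps power2_eq_square power3_eq_cube power4_eq_xxxx)
qed

text \<open>By \<open>C4_defect_identity\<close> a small defect controls both codegrees and degrees.
  The density \<open>e x\<close> of neighbours in \<open>Z\<close> differs from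
  \<open>\<alpha> * d x\<close> by an average against a mean-zero function, whose second moment over
  \<open>x\<close> expands into codegrees. Chebyshev then bounds the number of vertices that deviate
  by at least \<open>p * \<alpha> / 2\<close>.\<close>

lemma few_low_degrees:
  fixes f :: "'a \<Rightarrow> 'b \<Rightarrow> real"
  assumes X: "finite X" "X \<noteq> {}" and Y: "finite Y" "Y \<noteq> {}" and p: "0 < p"
    and defect: "avg Y (\<lambda>y. avg Y (\<lambda>y'. (avg X (\<lambda>x. f x y * f x y'))\<^sup>2))
           - 4 * p ^ 3 * avg X (\<lambda>x. avg Y (f x)) + 3 * p ^ 4 \<le> \<kappa>"
    and Z: "Z \<subseteq> Y"
  shows "(p * card Z / card Y)\<^sup>2 / 4 * card {x \<in> X. (\<Sum>y\<in>Z. f x y) < p / 2 * card Z}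
          \<le> (2 * sqrt \<kappa> + \<kappa> / p\<^sup>2) * card X"
proof -
  let ?c = "\<lambda>y y'. avg X (\<lambda>x. f x y * f x y')"
  define \<alpha> where "\<alpha> = card Z / card Y"
  \<comment> \<open>Centring the indicator makes its average over \<open>Y\<close> zero, so that
    \<open>p\<^sup>2\<close> can later be subtracted from every codegree for free.\<close>
  define u where "u y = indicator Z y - \<alpha>" for y
  define e where "e x = avg Y (\<lambda>y. indicator Z y * f x y)" for x
  define d where "d x = avg Y (f x)" for x
  have cY: "card Y > 0" and cX: "card X > 0" using X Y by (auto simp: card_gt_0_iff)
  have indZ: "avg Y (indicator Z) = \<alpha>"
    using Z Y by (simp add: avg_def \<alpha>_def indicator_def sum.If_cases Int_absorb1)
  have \<alpha>: "0 \<le> \<alpha>" "\<alpha> \<le> 1" using cY card_mono[OF Y(1) Z] by (auto simp: \<alpha>_def)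
  have "avg Y u = avg Y (indicator Z) - avg Y (\<lambda>_. \<alpha>)"
    unfolding avg_diff[symmetric] by (rule avg_cong) (simp add: u_def)
  then have u0: "avg Y u = 0" using indZ Y by (simp add: avg_const)
  have u1: "\<bar>u y\<bar> \<le> 1" for y using \<alpha> by (auto simp: u_def indicator_def)
  have both: "avg Y (\<lambda>y. avg Y (\<lambda>y'. (?c y y' - p\<^sup>2)\<^sup>2)) + 2 * p\<^sup>2 * avg X (\<lambda>x. (d x - p)\<^sup>2) \<le> \<kappa>"
    using defect C4_defect_identity[OF X Y, of f p] by (simp add: d_def)
  have n1: "0 \<le> avg Y (\<lambda>y. avg Y (\<lambda>y'. (?c y y' - p\<^sup>2)\<^sup>2))" and n2: "0 \<le> avg X (\<lambda>x. (d x - p)\<^sup>2)"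
    by (intro avg_nonneg; simp)+
  have cod: "avg Y (\<lambda>y. avg Y (\<lambda>y'. (?c y y' - p\<^sup>2)\<^sup>2)) \<le> \<kappa>"
    using both n2 p by (smt (verit) mult_nonneg_nonneg zero_le_power2)
  have deg: "avg X (\<lambda>x. (d x - p)\<^sup>2) \<le> \<kappa> / (2 * p\<^sup>2)"
    using both n1 p by (simp add: field_simps)
  have ed: "e x - \<alpha> * d x = avg Y (\<lambda>y. u y * f x y)" for x
    by (simp add: e_def d_def u_def left_diff_distrib avg_diff avg_cmult)
  have "avg X (\<lambda>x. (e x - \<alpha> * d x)\<^sup>2)
      = avg X (\<lambda>x. avg Y (\<lambda>y. avg Y (\<lambda>y'. u y * u y' * (f x y * f x y'))))"
    unfolding ed power2_eq_square avg_mult_avg by (intro avg_cong) (simp add: algebra_simps)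
  also have "\<dots> = avg Y (\<lambda>y. avg Y (\<lambda>y'. u y * u y' * ?c y y'))"
    by (subst avg_swap, rule avg_cong, subst avg_swap, simp add: avg_cmult)
  also have "\<dots> = avg Y (\<lambda>y. avg Y (\<lambda>y'. u y * u y' * (?c y y' - p\<^sup>2)))"
    by (simp add: right_diff_distrib avg_diff avg_multc avg_cmult u0)
  also have "\<dots> \<le> avg Y (\<lambda>y. avg Y (\<lambda>y'. \<bar>?c y y' - p\<^sup>2\<bar>))"
  proof (intro avg_mono)
    fix y y'
    have le1: "\<bar>u y * u y'\<bar> \<le> 1" using mult_mono[OF u1[of y] u1[of y']] by (simp add: abs_mult)
    have "u y * u y' * (?c y y' - p\<^sup>2) \<le> \<bar>u y * u y' * (?c y y' - p\<^sup>2)\<bar>" by (rule abs_ge_self)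
    also have "\<dots> = \<bar>u y * u y'\<bar> * \<bar>?c y y' - p\<^sup>2\<bar>" by (rule abs_mult)
    also have "\<dots> \<le> 1 * \<bar>?c y y' - p\<^sup>2\<bar>" using le1 by (rule mult_right_mono) simp
    finally show "u y * u y' * (?c y y' - p\<^sup>2) \<le> \<bar>?c y y' - p\<^sup>2\<bar>" by simp
  qed
  also have "\<dots> \<le> avg Y (\<lambda>y. sqrt (avg Y (\<lambda>y'. (?c y y' - p\<^sup>2)\<^sup>2)))"
    by (intro avg_mono avg_abs_le_sqrt Y)
  also have "\<dots> \<le> sqrt (avg Y (\<lambda>y. avg Y (\<lambda>y'. (?c y y' - p\<^sup>2)\<^sup>2)))"
  proof -
    have nn: "0 \<le> avg Y (\<lambda>y'. (?c y y' - p\<^sup>2)\<^sup>2)" for y by (rule avg_nonneg) simp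
    show ?thesis
      using avg_abs_le_sqrt[OF Y, of "\<lambda>y. sqrt (avg Y (\<lambda>y'. (?c y y' - p\<^sup>2)\<^sup>2))"]
      by (simp add: nn)
  qed
  also have "\<dots> \<le> sqrt \<kappa>" using cod by simp
  finally have a: "avg X (\<lambda>x. (e x - \<alpha> * d x)\<^sup>2) \<le> sqrt \<kappa>" .
  \<comment> \<open>The deviation splits into the uneven spread of the neighbourhood of
    \<open>x\<close> over \<open>Z\<close> and \<open>\<alpha>\<close> times the error of its
    degree.\<close>
  have "avg X (\<lambda>x. (e x - \<alpha> * p)\<^sup>2) \<le> avg X (\<lambda>x. 2 * (e x - \<alpha> * d x)\<^sup>2 + 2 * (d x - p)\<^sup>2)"
  proof (rule avg_mono)
    fix x
    let ?s = "e x - \<alpha> * d x" and ?t = "\<alpha> * (d x - p)"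
    have "(?s + ?t)\<^sup>2 \<le> 2 * ?s\<^sup>2 + 2 * ?t\<^sup>2"
      using sum_squares_bound[of ?s ?t] by (simp add: power2_sum)
    also have "?t\<^sup>2 \<le> (d x - p)\<^sup>2"
      using \<alpha> by (simp add: power_mult_distrib power_le_one mult_left_le_one_le)
    finally show "(e x - \<alpha> * p)\<^sup>2 \<le> 2 * ?s\<^sup>2 + 2 * (d x - p)\<^sup>2"
      by (simp add: algebra_simps)
  qed
  also have "\<dots> \<le> 2 * sqrt \<kappa> + \<kappa> / p\<^sup>2"
    using a deg p by (simp add: avg_add avg_cmult)
  finally have main: "avg X (\<lambda>x. (e x - \<alpha> * p)\<^sup>2) \<le> 2 * sqrt \<kappa> + \<kappa> / p\<^sup>2" .
  let ?L = "{x \<in> X. (\<Sum>y\<in>Z. f x y) < p / 2 * card Z}"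
  have low: "(p * \<alpha>)\<^sup>2 / 4 \<le> (e x - \<alpha> * p)\<^sup>2" if "x \<in> ?L" for x
  proof -
    have "e x = (\<Sum>y\<in>Z. f x y) / card Y"
      using Z Y by (simp add: e_def avg_def indicator_def Int_absorb1 if_distrib sum.If_cases cong: if_cong)
    also have "\<dots> \<le> (p / 2 * card Z) / card Y"
      using that by (intro divide_right_mono) auto
    also have "\<dots> = p * \<alpha> / 2" by (simp add: \<alpha>_def)
    finally have "p * \<alpha> / 2 \<le> \<alpha> * p - e x" by (simp add: algebra_simps)
    moreover have "0 \<le> p * \<alpha> / 2" using p \<alpha> by simp
    ultimately have "(p * \<alpha> / 2)\<^sup>2 \<le> (\<alpha> * p - e x)\<^sup>2" by (rule power_mono)
    then show ?thesis by (simp add: power_divide power2_commute)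
  qed
  have "(p * \<alpha>)\<^sup>2 / 4 * card ?L = (\<Sum>x\<in>?L. (p * \<alpha>)\<^sup>2 / 4)" by simp
  also have "\<dots> \<le> (\<Sum>x\<in>?L. (e x - \<alpha> * p)\<^sup>2)" by (rule sum_mono) (rule low)
  also have "\<dots> \<le> (\<Sum>x\<in>X. (e x - \<alpha> * p)\<^sup>2)"
    using X by (intro sum_mono2) auto
  also have "\<dots> \<le> (2 * sqrt \<kappa> + \<kappa> / p\<^sup>2) * card X"
    using main cX by (simp add: avg_def field_simps)
  finally show ?thesis by (simp add: \<alpha>_def)
qed

section \<open>Greedy choice of a clique\<close>

text \<open>Vertices are picked block by block. \<open>S b\<close> stands for the vertices of block
  \<open>b\<close> still joined to all \<open>a\<close> earlier choices; the invariant
  \<open>\<beta> ^ a * m\<close> keeps it large enough for \<open>low\<close>. The vertices that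
  would shrink some later candidate set by more than a factor \<open>\<beta>\<close> number fewer
  than \<open>\<beta> ^ k * m\<close>, so they cannot exhaust \<open>S a\<close>.\<close>

lemma greedy_clique:
  fixes V :: "nat \<Rightarrow> 'a set" and \<beta> \<tau> m :: real
  assumes fin: "\<And>a. a < k \<Longrightarrow> finite (V a)"
    and \<beta>: "0 < \<beta>" "\<beta> \<le> 1" and m: "0 < m" and \<tau>: "k * \<tau> < \<beta> ^ k"
    and low: "\<And>a b Y. a < b \<Longrightarrow> b < k \<Longrightarrow> Y \<subseteq> V b \<Longrightarrow> \<beta> ^ k * m \<le> card Y \<Longrightarrow>
        card {x \<in> V a. card {y \<in> Y. G x y} < \<beta> * card Y} \<le> \<tau> * m"
  shows "a \<le> k \<Longrightarrow> (\<And>b. a \<le> b \<Longrightarrow> b < k \<Longrightarrow> S b \<subseteq> V b \<and> \<beta> ^ a * m \<le> card (S b)) \<Longrightarrow>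
     \<exists>y. (\<forall>b. a \<le> b \<and> b < k \<longrightarrow> y b \<in> S b) \<and> (\<forall>b c. a \<le> b \<and> b < c \<and> c < k \<longrightarrow> G (y b) (y c))"
proof (induction "k - a" arbitrary: a S)
  case 0
  then show ?case by force
next
  case (Suc j)
  then have a: "a < k" by simp
  let ?Bad = "\<lambda>b. {x \<in> V a. card {y \<in> S b. G x y} < \<beta> * card (S b)}"
  have pow: "\<beta> ^ k \<le> \<beta> ^ a" using \<beta> a by (intro power_decreasing) auto
  have big: "\<beta> ^ k * m \<le> card (S b)" if "a \<le> b" "b < k" for b
    using Suc.prems(2)[OF that] mult_right_mono[OF pow, of m] m by linarith
  have bad: "real (card (?Bad b)) \<le> \<tau> * m" if "b \<in> {a<..<k}" for b
    using that Suc.prems(2)[of b] big[of b] by (intro low) auto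
  have fBad: "finite (\<Union>b\<in>{a<..<k}. ?Bad b)"
    using fin[OF a] by auto
  \<comment> \<open>The sign of \<open>\<tau>\<close> comes from \<open>low\<close>, which bounds a
    cardinality as soon as a later block exists. Without later blocks the union is empty and the
    estimate below is trivial.\<close>
  have \<tau>0: "0 \<le> \<tau>" if ne: "{a<..<k} \<noteq> {}"
  proof -
    obtain b where "b \<in> {a<..<k}" using ne by blast
    then have "0 \<le> \<tau> * m" using bad[of b] by (smt (verit) of_nat_0_le_iff)
    then show ?thesis using m by (simp add: zero_le_mult_iff)
  qed
  have "real (card (\<Union>b\<in>{a<..<k}. ?Bad b)) \<le> (\<Sum>b\<in>{a<..<k}. real (card (?Bad b)))"
    unfolding of_nat_sum[symmetric] of_nat_le_iff by (rule card_UN_le) simp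
  also have "\<dots> \<le> (\<Sum>b\<in>{a<..<k}. \<tau> * m)" by (rule sum_mono) (rule bad)
  also have "\<dots> = real (card {a<..<k}) * (\<tau> * m)" by simp
  also have "\<dots> < \<beta> ^ k * m"
  proof (cases "{a<..<k} = {}")
    case True
    then show ?thesis using \<beta> m by simp
  next
    case False
    have "real (card {a<..<k}) * (\<tau> * m) \<le> k * (\<tau> * m)"
      using \<tau>0[OF False] m by (intro mult_right_mono) auto
    also have "\<dots> < \<beta> ^ k * m" using \<tau> m by (simp add: mult.assoc[symmetric])
    finally show ?thesis .
  qed
  also have "\<dots> \<le> card (S a)" using big[of a] a by simp
  finally have "card (\<Union>b\<in>{a<..<k}. ?Bad b) < card (S a)" by simp
  then have "\<not> S a \<subseteq> (\<Union>b\<in>{a<..<k}. ?Bad b)"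
    using card_mono[OF fBad] by (meson linorder_not_less)
  then obtain x where x: "x \<in> S a" "x \<notin> (\<Union>b\<in>{a<..<k}. ?Bad b)" by blast
  have xV: "x \<in> V a" using x(1) Suc.prems(2)[of a] a by auto
  define S' where "S' b = {y \<in> S b. G x y}" for b
  have "S' b \<subseteq> V b \<and> \<beta> ^ Suc a * m \<le> card (S' b)" if "Suc a \<le> b" "b < k" for b
  proof -
    have "\<beta> * card (S b) \<le> card (S' b)"
      using x(2) xV that by (force simp: S'_def not_less)
    moreover have "\<beta> * (\<beta> ^ a * m) \<le> \<beta> * card (S b)"
      using Suc.prems(2)[of b] that \<beta> by (intro mult_left_mono) auto
    ultimately show ?thesis using Suc.prems(2)[of b] that by (auto simp: S'_def mult.assoc)
  qed
  moreover have "j = k - Suc a" "Suc a \<le> k" using Suc.hyps(2) a by auto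
  ultimately obtain y where y: "\<forall>b. Suc a \<le> b \<and> b < k \<longrightarrow> y b \<in> S' b"
      "\<forall>b c. Suc a \<le> b \<and> b < c \<and> c < k \<longrightarrow> G (y b) (y c)"
    using Suc.hyps(1)[of "Suc a" S'] by blast
  show ?case
    by (rule exI[of _ "y(a := x)"]) (use x(1) y in \<open>auto simp: S'_def Suc_le_eq dest: le_neq_implies_less\<close>)
qed

section \<open>Pairs of vertices, and densities as averages\<close>

lemma mem_pairs_iff: "e \<in> pairs S \<longleftrightarrow> (\<exists>u v. u \<in> S \<and> v \<in> S \<and> u \<noteq> v \<and> e = {u, v})"
  by (auto simp: pairs_def card_2_iff)

lemma pairs_empty [simp]: "pairs {} = {}"
  by (auto simp: mem_pairs_iff)

lemma pairs_mono: "S \<subseteq> T \<Longrightarrow> pairs S \<subseteq> pairs T"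
  by (auto simp: pairs_def)

lemma pairs_insert: "v \<notin> S \<Longrightarrow> pairs (insert v S) = pairs S \<union> (\<lambda>u. {v, u}) ` S"
  unfolding set_eq_iff mem_pairs_iff Un_iff image_iff by (auto 4 4 simp: insert_commute)

lemma finite_edges [simp]: "finite (edges n)"
  unfolding edges_def pairs_def by (rule finite_subset[of _ "Pow {1..n}"]) auto

lemma mu_eq_avg: "mu n A = avg (Pow (edges n)) (\<lambda>W. of_bool (W \<in> A))"
  by (simp add: mu_def avg_def card_Pow of_bool_def sum.If_cases Int_commute)

text \<open>Drawing from all of \<open>edges n\<close> and then erasing the pairs of the quadruple
  gives the same law as drawing off these pairs. This puts all events on one probability
  space.\<close>

lemma box_prob_eq_avg:
  assumes "{i, j, k, l} \<subseteq> {1..n}"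
  shows "box_prob n A i j k l = avg (Pow (edges n)) (\<lambda>W. of_bool
     (let H = W - pairs {i, j, k, l} in insert {i,k} H \<in> A \<and> insert {i,l} H \<in> A
       \<and> insert {j,k} H \<in> A \<and> insert {j,l} H \<in> A))"
proof -
  let ?B = "pairs {i, j, k, l}" and ?E = "edges n"
  define Q where "Q H \<longleftrightarrow> insert {i,k} H \<in> A \<and> insert {i,l} H \<in> A
       \<and> insert {j,k} H \<in> A \<and> insert {j,l} H \<in> A" for H
  have B: "?B \<subseteq> ?E" unfolding edges_def by (rule pairs_mono[OF assms])
  have fB: "finite ?B" by (rule finite_subset[OF B]) simp
  have cE: "card ?E = card ?B + card (?E - ?B)"
    using card_Un_disjoint[of ?B "?E - ?B"] B fB by (simp only: Un_Diff_cancel Un_absorb1) simp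
  have "(\<Sum>W\<in>Pow ?E. of_bool (Q (W - ?B))) = 2 ^ card ?B * (\<Sum>W | W \<subseteq> ?E \<and> W \<inter> ?B = {}. of_bool (Q W) :: real)"
    using sum_Pow_override[of ?E ?B "{}" "\<lambda>W. of_bool (Q W)"] B by simp
  also have "{W. W \<subseteq> ?E \<and> W \<inter> ?B = {}} = Pow (?E - ?B)" by blast
  also have "(\<Sum>W\<in>Pow (?E - ?B). of_bool (Q W) :: real) = card {W. W \<subseteq> ?E - ?B \<and> Q W}"
    by (simp add: of_bool_def sum.If_cases Int_def)
  finally show ?thesis
    by (simp add: box_prob_def Let_def avg_def card_Pow cE power_add Q_def[symmetric])
qed

lemma avg_of_bool_le:
  assumes "finite T" "inj_on g {s \<in> S. P s}" "\<And>s. s \<in> S \<Longrightarrow> P s \<Longrightarrow> g s \<in> T" "finite S"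
  shows "avg S (\<lambda>s. of_bool (P s)) \<le> card T / card S"
proof -
  have "card {s \<in> S. P s} \<le> card T"
    using assms by (intro card_inj_on_le[of g]) auto
  then show ?thesis
    using assms(4) by (simp add: avg_def of_bool_def sum.If_cases Int_def divide_right_mono)
qed

lemma avg_Times: "avg (S \<times> T) f = avg S (\<lambda>s. avg T (\<lambda>t. f (s, t)))"
  by (simp add: avg_def sum.cartesian_product' card_cartesian_product
      sum_divide_distrib[symmetric] mult.commute)

section \<open>Random vertices from consecutive intervals\<close>

text \<open>One interval per chosen vertex makes the vertices distinct and their order known, so that
  every four positions yield a quadruple \<open>i < j < k < l\<close> as in the definition of quasirandomness.\<close>

locale interval_sample =
  fixes n q L :: nat
  assumes q_pos: "0 < q" and L_pos: "0 < L" and fits: "q * L \<le> n"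
begin

definition V :: "nat \<Rightarrow> nat set" where
  "V p = {p * L + 1..p * L + L}"

abbreviation "\<Omega> \<equiv> PiE {..<q} V"
abbreviation "E \<equiv> edges n"

text \<open>Error of erasing all pairs inside the sample: at most \<open>q\<close> vertices are
  added, each at cost \<open>sqrt (2 ^ q / L)\<close>.\<close>

definition \<eta> :: real where
  "\<eta> = q * sqrt (2 ^ q / L)"

lemma finite_V [simp]: "finite (V p)" and V_nonempty [simp]: "V p \<noteq> {}" and card_V [simp]: "card (V p) = L"
  using L_pos by (auto simp: V_def)

lemma V_subset:
  assumes "p < q"
  shows "V p \<subseteq> {1..n}"
proof -
  have "p * L + L \<le> q * L" using mult_le_mono1[of "Suc p" q L] assms by simp
  then show ?thesis using fits by (auto simp: V_def)
qed

lemma V_less: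
  assumes "p < r" "v \<in> V p" "w \<in> V r"
  shows "v < w"
proof -
  have "p * L + L \<le> r * L" using mult_le_mono1[of "Suc p" r L] assms(1) by simp
  then show ?thesis using assms by (auto simp: V_def)
qed

lemma finite_\<Omega> [simp]: "finite \<Omega>"
  by (simp add: finite_PiE)

lemma \<Omega>_nonempty [simp]: "\<Omega> \<noteq> {}"
  by (simp add: PiE_eq_empty_iff)

lemma \<Omega>_V: "x \<in> \<Omega> \<Longrightarrow> p < q \<Longrightarrow> x p \<in> V p"
  by auto

lemma \<Omega>_less: "x \<in> \<Omega> \<Longrightarrow> p < r \<Longrightarrow> r < q \<Longrightarrow> x p < x r"
  by (rule V_less[of p r]) (simp_all add: \<Omega>_V)

lemma \<Omega>_image_subset: "x \<in> \<Omega> \<Longrightarrow> S \<subseteq> {..<q} \<Longrightarrow> x ` S \<subseteq> {1..n}"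
  using V_subset by blast

text \<open>Adding \<open>v\<close> erases in addition the star from \<open>v\<close> to the
  vertices already chosen. The stars of different \<open>v\<close> are disjoint and have at most
  \<open>q\<close> pairs, so \<open>avg_override_blocks\<close> applies with empty prescribed
  traces.\<close>

lemma avg_add_vertex:
  fixes F :: "nat set set \<Rightarrow> real"
  assumes x: "x \<in> \<Omega>" and S: "S \<subseteq> {..<q}" and r: "r < q" "r \<notin> S"
    and F: "\<And>W. 0 \<le> F W" "\<And>W. F W \<le> 1"
  shows "\<bar>avg (V r) (\<lambda>v. avg (Pow E) (\<lambda>W. F (W - pairs (insert v (x ` S)))))
            - avg (Pow E) (\<lambda>W. F (W - pairs (x ` S)))\<bar> \<le> sqrt (2 ^ q / L)"
proof -
  let ?B = "\<lambda>v. (\<lambda>u. {v, u}) ` (x ` S)"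
  have notin: "v \<notin> x ` S" if "v \<in> V r" for v
  proof
    assume "v \<in> x ` S"
    then obtain s where s: "s \<in> S" "v = x s" by blast
    with S x have "v \<in> V s" by auto
    moreover have "s < r \<or> r < s" using s r by (metis nat_neq_iff)
    ultimately show False using V_less[of s r v v] V_less[of r s v v] that by auto
  qed
  have eq: "W - pairs (insert v (x ` S)) = (W - ?B v \<union> {}) - pairs (x ` S)" if "v \<in> V r" for v W
    using pairs_insert[OF notin[OF that]] by blast
  have fS: "finite S" "card S \<le> q"
    using S finite_subset card_mono[OF _ S] by auto
  have "\<bar>avg (V r) (\<lambda>v. avg (Pow E) (\<lambda>W. F ((W - ?B v \<union> {}) - pairs (x ` S))))
            - avg (Pow E) (\<lambda>W. F (W - pairs (x ` S)))\<bar> \<le> sqrt (2 ^ q / card (V r))"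
  proof (rule avg_override_blocks[where F = "\<lambda>W. F (W - pairs (x ` S))" and B = ?B and T = "\<lambda>_. {}"])
    fix v assume v: "v \<in> V r"
    have "?B v \<subseteq> pairs (insert v (x ` S))" using pairs_insert[OF notin[OF v]] by blast
    also have "\<dots> \<subseteq> E"
      unfolding edges_def using v V_subset[OF r(1)] \<Omega>_image_subset[OF x S] by (intro pairs_mono) auto
    finally show "?B v \<subseteq> E" .
    show "card (?B v) \<le> q"
      using card_image_le[of S x] card_image_le[of "x ` S" "\<lambda>u. {v, u}"] fS by simp
  next
    fix v w assume "v \<in> V r" "w \<in> V r" "v \<noteq> w"
    then show "?B v \<inter> ?B w = {}" using notin[of v] notin[of w] by (auto simp: doubleton_eq_iff)
  qed (use F in auto)
  then show ?thesis using eq by (simp cong: avg_cong)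
qed

text \<open>The positions outside \<open>P\<close> are added one at a time, each redrawn and handled
  by \<open>avg_add_vertex\<close>. By \<open>dep\<close>, redrawing such a position leaves
  \<open>F\<close> alone and changes only the erased pairs.\<close>

lemma avg_erase_sample:
  fixes F :: "(nat \<Rightarrow> nat) \<Rightarrow> nat set set \<Rightarrow> real"
  assumes P: "P \<subseteq> {..<q}" and F: "\<And>x W. 0 \<le> F x W" "\<And>x W. F x W \<le> 1"
    and dep: "\<And>x r v. r \<notin> P \<Longrightarrow> F (x(r := v)) = F x"
  shows "\<bar>avg \<Omega> (\<lambda>x. avg (Pow E) (\<lambda>W. F x (W - pairs (x ` {..<q}))))
           - avg \<Omega> (\<lambda>x. avg (Pow E) (\<lambda>W. F x (W - pairs (x ` P))))\<bar> \<le> \<eta>"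
proof -
  define g where "g S x = avg (Pow E) (\<lambda>W. F x (W - pairs (x ` S)))" for S x
  have "T \<inter> P = {} \<Longrightarrow> T \<subseteq> {..<q} \<Longrightarrow> \<bar>avg \<Omega> (g (P \<union> T)) - avg \<Omega> (g P)\<bar> \<le> card T * sqrt (2 ^ q / L)"
    if "finite T" for T
    using that
  proof (induction T rule: finite_induct)
    case (insert r T)
    let ?S = "P \<union> T"
    have r: "r < q" "r \<notin> ?S" "r \<notin> P" "?S \<subseteq> {..<q}" using insert P by auto
    have "avg \<Omega> (g (insert r ?S)) = avg \<Omega> (\<lambda>x. avg (V r) (\<lambda>v. g (insert r ?S) (x(r := v))))"
      using r by (intro avg_PiE_resample[symmetric]) auto
    also have "\<dots> = avg \<Omega> (\<lambda>x. avg (V r) (\<lambda>v. avg (Pow E) (\<lambda>W. F x (W - pairs (insert v (x ` ?S))))))"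
    proof -
      have "(x(r := v)) ` insert r ?S = insert v (x ` ?S)" for x :: "nat \<Rightarrow> nat" and v using r by auto
      then show ?thesis by (simp only: g_def dep[OF r(3)])
    qed
    finally have "\<bar>avg \<Omega> (g (insert r ?S)) - avg \<Omega> (g ?S)\<bar>
        \<le> avg \<Omega> (\<lambda>x. \<bar>avg (V r) (\<lambda>v. avg (Pow E) (\<lambda>W. F x (W - pairs (insert v (x ` ?S))))) - g ?S x\<bar>)"
      by (simp add: avg_diff[symmetric] avg_abs)
    also have "\<dots> \<le> sqrt (2 ^ q / L)"
      unfolding g_def using avg_add_vertex[OF _ r(4,1,2)] F by (intro avg_le_const) auto
    finally show ?case using insert by (simp add: algebra_simps)
  qed (simp)
  from this[of "{..<q} - P"] have "\<bar>avg \<Omega> (g {..<q}) - avg \<Omega> (g P)\<bar> \<le> card ({..<q} - P) * sqrt (2 ^ q / L)"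
    using P by (simp add: Un_absorb1 Diff_Int_distrib2)
  also have "\<dots> \<le> \<eta>"
    unfolding \<eta>_def using card_mono[of "{..<q}" "{..<q} - P"] by (intro mult_right_mono) auto
  finally show ?thesis by (simp add: g_def[abs_def])
qed

definition erased :: "(nat \<Rightarrow> nat) \<Rightarrow> nat set set \<Rightarrow> nat set set" where
  "erased x W = W - pairs (x ` {..<q})"

text \<open>Adjacency of the positions \<open>p\<close> and \<open>r\<close> in the random graph
  given by the sample and the graph in \<open>\<omega>\<close>, as a 0/1 real so that it can be
  averaged.\<close>

definition link :: "nat set set set \<Rightarrow> (nat \<Rightarrow> nat) \<times> nat set set \<Rightarrow> nat \<Rightarrow> nat \<Rightarrow> real" where
  "link A \<omega> p r = of_bool (insert {fst \<omega> p, fst \<omega> r} (erased (fst \<omega>) (snd \<omega>)) \<in> A)"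

lemma avg_erased_mem:
  "mu n A - \<eta> \<le> avg (\<Omega> \<times> Pow E) (\<lambda>\<omega>. of_bool (erased (fst \<omega>) (snd \<omega>) \<in> A))"
  using avg_erase_sample[of "{}" "\<lambda>x W. of_bool (W \<in> A)"]
  by (simp add: mu_eq_avg avg_const erased_def avg_Times)

text \<open>When only the pair of the two vertices is erased, inserting it again overrides a
  one-element block with full trace. Letting \<open>x r\<close> vary over \<open>V r\<close> gives
  \<open>L\<close> disjoint blocks, whence the extra error \<open>sqrt (2 / L)\<close>.\<close>

lemma avg_link:
  assumes pr: "p < r" "r < q"
  shows "mu n A - \<eta> - sqrt (2 / L) \<le> avg (\<Omega> \<times> Pow E) (\<lambda>\<omega>. link A \<omega> p r)"
proof -
  let ?F = "\<lambda>x W. of_bool (insert {x p, x r} W \<in> A) :: real"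
  let ?G = "\<lambda>x v. avg (Pow E) (\<lambda>W. of_bool ((W - {{x p, v}} \<union> {{x p, v}}) \<in> A)) :: real"
  have "avg \<Omega> (\<lambda>x. avg (Pow E) (\<lambda>W. ?F x (W - pairs (x ` {p, r})))) = avg \<Omega> (\<lambda>x. ?G x (x r))"
  proof (intro avg_cong)
    fix x W assume "x \<in> \<Omega>"
    then have "x p \<noteq> x r" using \<Omega>_less pr by fastforce
    then have "pairs (x ` {p, r}) = {{x p, x r}}" by (auto simp: pairs_insert)
    then show "?F x (W - pairs (x ` {p, r})) = of_bool ((W - {{x p, x r}} \<union> {{x p, x r}}) \<in> A)" by simp
  qed
  also have "\<dots> = avg \<Omega> (\<lambda>x. avg (V r) (?G x))"
    using pr avg_PiE_resample[of r "{..<q}" V "\<lambda>x. ?G x (x r)"] by simp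
  finally have eq: "avg \<Omega> (\<lambda>x. avg (Pow E) (\<lambda>W. ?F x (W - pairs (x ` {p, r})))) = \<dots>" .
  have "mu n A - sqrt (2 / L) \<le> avg \<Omega> (\<lambda>x. avg (V r) (?G x))"
  proof (rule avg_ge_const)
    fix x assume x: "x \<in> \<Omega>"
    have lt: "x p < v" if "v \<in> V r" for v
      using V_less[OF pr(1) _ that] \<Omega>_V[OF x] pr by simp
    have xp: "x p \<in> {1..n}" using V_subset[of p] \<Omega>_V[OF x, of p] pr by auto
    have "\<bar>avg (V r) (?G x) - avg (Pow E) (\<lambda>W. of_bool (W \<in> A))\<bar> \<le> sqrt (2 ^ 1 / card (V r))"
    proof (rule avg_override_blocks[where F = "\<lambda>W. of_bool (W \<in> A)"
          and B = "\<lambda>v. {{x p, v}}" and T = "\<lambda>v. {{x p, v}}"])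
      fix v assume "v \<in> V r"
      then show "{{x p, v}} \<subseteq> E"
        using xp V_subset[OF pr(2)] lt[of v] by (auto simp: edges_def pairs_def)
    qed (auto simp: doubleton_eq_iff)
    then show "mu n A - sqrt (2 / L) \<le> avg (V r) (?G x)" by (simp add: mu_eq_avg)
  qed auto
  moreover have "\<bar>avg \<Omega> (\<lambda>x. avg (Pow E) (\<lambda>W. ?F x (W - pairs (x ` {..<q}))))
           - avg \<Omega> (\<lambda>x. avg (Pow E) (\<lambda>W. ?F x (W - pairs (x ` {p, r}))))\<bar> \<le> \<eta>"
    using pr by (intro avg_erase_sample) auto
  ultimately show ?thesis
    unfolding eq by (simp add: link_def erased_def avg_Times)
qed

text \<open>When only the pairs of the four vertices are erased, the average for fixed
  \<open>x\<close> is \<open>box_prob\<close>. The last error term bounds the chance of an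
  exceptional quadruple: at most \<open>\<theta> * (n choose 4)\<close> sets against
  \<open>L ^ 4\<close> equally likely choices.\<close>

lemma avg_link_cycle:
  assumes qr: "quasirandom \<theta> n A" and \<theta>: "0 < \<theta>"
    and p: "p1 < p2" "p2 < p3" "p3 < p4" "p4 < q"
  shows "avg (\<Omega> \<times> Pow E) (\<lambda>\<omega>. link A \<omega> p1 p3 * link A \<omega> p1 p4 * link A \<omega> p2 p3 * link A \<omega> p2 p4)
     \<le> mu n A ^ 4 + \<theta> + \<eta> + \<theta> * real (n choose 4) / L ^ 4"
proof -
  obtain U where U: "U \<subseteq> quads {1..n}" "real (card U) \<ge> (1 - \<theta>) * real (n choose 4)"
    "\<And>i j k l. {i, j, k, l} \<in> U \<Longrightarrow> i < j \<Longrightarrow> j < k \<Longrightarrow> k < l \<Longrightarrow> box_prob n A i j k l \<le> mu n A ^ 4 + \<theta>"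
    using qr unfolding quasirandom_def by blast
  let ?P = "{p1, p2, p3, p4}"
  define F where "F x W = (of_bool (insert {x p1, x p3} W \<in> A \<and> insert {x p1, x p4} W \<in> A
     \<and> insert {x p2, x p3} W \<in> A \<and> insert {x p2, x p4} W \<in> A) :: real)" for x :: "nat \<Rightarrow> nat" and W
  let ?q = "\<lambda>x. {x p1, x p2, x p3, x p4} :: nat set"
  have mu0: "0 \<le> mu n A" by (simp add: mu_def)
  have "avg \<Omega> (\<lambda>x. avg (Pow E) (\<lambda>W. F x (W - pairs (x ` ?P))))
      \<le> avg \<Omega> (\<lambda>x. mu n A ^ 4 + \<theta> + of_bool (?q x \<notin> U))"
  proof (rule avg_mono)
    fix x assume x: "x \<in> \<Omega>"
    have lt: "x p1 < x p2" "x p2 < x p3" "x p3 < x p4" using \<Omega>_less[OF x] p by auto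
    have "avg (Pow E) (\<lambda>W. F x (W - pairs (x ` ?P))) = box_prob n A (x p1) (x p2) (x p3) (x p4)"
      using \<Omega>_image_subset[OF x, of ?P] p by (subst box_prob_eq_avg) (auto simp: F_def Let_def)
    moreover have "avg (Pow E) (\<lambda>W. F x (W - pairs (x ` ?P))) \<le> 1"
      by (rule avg_le_const) (auto simp: F_def)
    ultimately show "avg (Pow E) (\<lambda>W. F x (W - pairs (x ` ?P))) \<le> mu n A ^ 4 + \<theta> + of_bool (?q x \<notin> U)"
      using U(3)[OF _ lt] \<theta> mu0 by (cases "?q x \<in> U") (auto intro: add_increasing)
  qed
  also have "\<dots> = mu n A ^ 4 + \<theta> + avg \<Omega> (\<lambda>x. of_bool (?q x \<notin> U))"
    by (simp add: avg_add avg_const)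
  also have "avg \<Omega> (\<lambda>x. of_bool (?q x \<notin> U)) \<le> \<theta> * real (n choose 4) / L ^ 4"
  proof -
    let ?S = "V p1 \<times> V p2 \<times> V p3 \<times> V p4"
    have ne: "p1 \<noteq> p2" "p1 \<noteq> p3" "p1 \<noteq> p4" "p2 \<noteq> p3" "p2 \<noteq> p4" "p3 \<noteq> p4" using p by auto
    \<comment> \<open>Redrawing the four coordinates in turn exposes them as independent uniform
      vertices; the inner average no longer depends on \<open>x\<close>.\<close>
    have "avg \<Omega> (\<lambda>x. of_bool (?q x \<notin> U)) = avg \<Omega> (\<lambda>x.
        avg (V p1) (\<lambda>a. avg (V p2) (\<lambda>b. avg (V p3) (\<lambda>c. avg (V p4) (\<lambda>d. of_bool ({a, b, c, d} \<notin> U))))))"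
      (is "avg \<Omega> ?h = _")
    proof -
      have "avg \<Omega> ?h = avg \<Omega> (\<lambda>x. avg (V p4) (\<lambda>d. ?h (x(p4 := d))))"
        using p by (intro avg_PiE_resample[symmetric]) auto
      also have "\<dots> = avg \<Omega> (\<lambda>x. avg (V p3) (\<lambda>c. avg (V p4) (\<lambda>d. ?h (x(p3 := c, p4 := d)))))"
        using p by (intro avg_PiE_resample[symmetric]) auto
      also have "\<dots> = avg \<Omega> (\<lambda>x.
          avg (V p2) (\<lambda>b. avg (V p3) (\<lambda>c. avg (V p4) (\<lambda>d. ?h (x(p2 := b, p3 := c, p4 := d))))))"
        using p by (intro avg_PiE_resample[symmetric]) auto
      also have "\<dots> = avg \<Omega> (\<lambda>x.
          avg (V p1) (\<lambda>a. avg (V p2) (\<lambda>b. avg (V p3) (\<lambda>c. avg (V p4) (\<lambda>d. ?h (x(p1 := a, p2 := b, p3 := c, p4 := d)))))))"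
        using p by (intro avg_PiE_resample[symmetric]) auto
      finally show ?thesis using ne by simp
    qed
    also have "\<dots> = avg ?S (\<lambda>(a, b, c, d). of_bool ({a, b, c, d} \<notin> U))"
      by (simp add: avg_const avg_Times)
    also have "\<dots> = avg ?S (\<lambda>s. of_bool (case s of (a, b, c, d) \<Rightarrow> {a, b, c, d} \<notin> U))"
      by (rule avg_cong) auto
    also have "\<dots> \<le> card (quads {1..n} - U) / card ?S"
    proof (rule avg_of_bool_le[where g = "\<lambda>(a, b, c, d). {a, b, c, d}"])
      show "finite (quads {1..n} - U)"
        unfolding quads_def by (rule finite_subset[of _ "Pow {1..n}"]) auto
      have lt: "a < b \<and> b < c \<and> c < d" if "a \<in> V p1" "b \<in> V p2" "c \<in> V p3" "d \<in> V p4" for a b c d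
        using that V_less p by blast
      show "inj_on (\<lambda>(a, b, c, d). {a, b, c, d}) {s \<in> ?S. case s of (a, b, c, d) \<Rightarrow> {a, b, c, d} \<notin> U}"
      proof (rule inj_onI, clarsimp)
        fix a b c d a' b' c' d'
        assume s: "{a, b, c, d} = {a', b', c', d'}" and
          V: "a \<in> V p1" "b \<in> V p2" "c \<in> V p3" "d \<in> V p4" "a' \<in> V p1" "b' \<in> V p2" "c' \<in> V p3" "d' \<in> V p4"
        \<comment> \<open>The intervals are ordered, so sorting the set recovers the tuple.\<close>
        have "sorted_list_of_set (set [a, b, c, d]) = [a, b, c, d]"
          using lt[OF V(1-4)] by (intro sorted_list_of_set.idem_if_sorted_distinct) auto
        moreover have "sorted_list_of_set (set [a', b', c', d']) = [a', b', c', d']"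
          using lt[OF V(5-8)] by (intro sorted_list_of_set.idem_if_sorted_distinct) auto
        ultimately show "a = a' \<and> b = b' \<and> c = c' \<and> d = d'" using s by simp
      qed
      fix s assume s: "s \<in> ?S" and sU: "case s of (a, b, c, d) \<Rightarrow> {a, b, c, d} \<notin> U"
      obtain a b c d where [simp]: "s = (a, b, c, d)" using prod_cases4 by blast
      have V: "a \<in> V p1" "b \<in> V p2" "c \<in> V p3" "d \<in> V p4" using s by auto
      have "card {a, b, c, d} = 4" using lt[OF V] by auto
      moreover have "{a, b, c, d} \<subseteq> {1..n}" using V V_subset p
        by (meson empty_subsetI insert_subset order.strict_trans subsetD)
      ultimately show "(case s of (a, b, c, d) \<Rightarrow> {a, b, c, d}) \<in> quads {1..n} - U"
        using sU by (simp add: quads_def)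
    qed simp
    also have "real (card (quads {1..n} - U)) = real (n choose 4) - card U"
    proof -
      have fq: "finite (quads {1..n})" unfolding quads_def by (rule finite_subset[of _ "Pow {1..n}"]) auto
      have "card (quads {1..n}) = n choose 4" using n_subsets[of "{1..n}" 4] by (simp add: quads_def)
      then show ?thesis using U(1) fq card_mono[OF fq U(1)]
        by (simp add: card_Diff_subset finite_subset of_nat_diff)
    qed
    also have "real (card ?S) = L ^ 4" by (simp add: card_cartesian_product power4_eq_xxxx)
    also have "(real (n choose 4) - card U) / L ^ 4 \<le> \<theta> * real (n choose 4) / L ^ 4"
      using U(2) by (intro divide_right_mono) (auto simp: algebra_simps)
    finally show ?thesis by simp
  qed
  finally have "avg \<Omega> (\<lambda>x. avg (Pow E) (\<lambda>W. F x (W - pairs (x ` ?P))))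
      \<le> mu n A ^ 4 + \<theta> + \<theta> * real (n choose 4) / L ^ 4"
    by simp
  moreover have "\<bar>avg \<Omega> (\<lambda>x. avg (Pow E) (\<lambda>W. F x (W - pairs (x ` {..<q}))))
           - avg \<Omega> (\<lambda>x. avg (Pow E) (\<lambda>W. F x (W - pairs (x ` ?P))))\<bar> \<le> \<eta>"
    using p by (intro avg_erase_sample) (auto simp: F_def fun_eq_iff)
  moreover have "avg \<Omega> (\<lambda>x. avg (Pow E) (\<lambda>W. F x (W - pairs (x ` {..<q}))))
     = avg (\<Omega> \<times> Pow E) (\<lambda>\<omega>. link A \<omega> p1 p3 * link A \<omega> p1 p4 * link A \<omega> p2 p3 * link A \<omega> p2 p4)"
    unfolding avg_Times by (intro avg_cong) (auto simp: F_def link_def erased_def)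
  ultimately show ?thesis by simp
qed

end

section \<open>Mean four-cycle defect of a random bipartite graph\<close>

text \<open>The identity displays the defect as a nonnegative combination of averaged squares. This
  is what a Markov bound over random graphs requires.\<close>

lemma C4_defect_nonneg:
  fixes f :: "'a \<Rightarrow> 'b \<Rightarrow> real"
  assumes X: "finite X" "X \<noteq> {}" and Y: "finite Y" "Y \<noteq> {}"
  shows "0 \<le> avg Y (\<lambda>y. avg Y (\<lambda>y'. (avg X (\<lambda>x. f x y * f x y'))\<^sup>2))
           - 4 * p ^ 3 * avg X (\<lambda>x. avg Y (f x)) + 3 * p ^ 4"
  unfolding C4_defect_identity[OF X Y]
  by (intro add_nonneg_nonneg mult_nonneg_nonneg avg_nonneg) auto

lemma avg_diagonal:
  assumes "finite S" "S \<noteq> {}"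
  shows "avg S (\<lambda>s. avg S (\<lambda>s'. of_bool (s = s'))) = 1 / card S"
proof -
  have "avg S (\<lambda>s'. of_bool (s = s')) = 1 / card S" if "s \<in> S" for s
    using that assms by (simp add: avg_def of_bool_def)
  then show ?thesis using assms by (simp add: avg_const cong: avg_cong)
qed

text \<open>The squared codegrees expand into closed walks through \<open>x, y, x', y'\<close>.
  Proper four-cycles are controlled by \<open>cyc\<close>; a degenerate walk counts at most 1, and
  those with \<open>x = x'\<close> or \<open>y = y'\<close> have shares \<open>1 / card X\<close>
  and \<open>1 / card Y\<close>. The linear term has a negative sign, so it calls for a lower bound
  on densities.\<close>

lemma avg_C4_defect_le:
  fixes f :: "'w \<Rightarrow> 'a \<Rightarrow> 'b \<Rightarrow> real"
  assumes Q: "finite Q" "Q \<noteq> {}" and X: "finite X" "X \<noteq> {}" and Y: "finite Y" "Y \<noteq> {}"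
    and f01: "\<And>\<omega> x y. 0 \<le> f \<omega> x y" "\<And>\<omega> x y. f \<omega> x y \<le> 1" and p: "0 \<le> p" and c: "0 \<le> c"
    and cyc: "\<And>x x' y y'. x \<in> X \<Longrightarrow> x' \<in> X \<Longrightarrow> y \<in> Y \<Longrightarrow> y' \<in> Y \<Longrightarrow> x \<noteq> x' \<Longrightarrow> y \<noteq> y' \<Longrightarrow>
       avg Q (\<lambda>\<omega>. f \<omega> x y * f \<omega> x y' * f \<omega> x' y * f \<omega> x' y') \<le> c"
    and den: "\<And>x y. x \<in> X \<Longrightarrow> y \<in> Y \<Longrightarrow> d \<le> avg Q (\<lambda>\<omega>. f \<omega> x y)"
  shows "avg Q (\<lambda>\<omega>. avg Y (\<lambda>y. avg Y (\<lambda>y'. (avg X (\<lambda>x. f \<omega> x y * f \<omega> x y'))\<^sup>2))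
           - 4 * p ^ 3 * avg X (\<lambda>x. avg Y (f \<omega> x)) + 3 * p ^ 4)
         \<le> c + 1 / card X + 1 / card Y - 4 * p ^ 3 * d + 3 * p ^ 4"
proof -
  let ?h = "\<lambda>\<omega> x x' y y'. f \<omega> x y * f \<omega> x y' * f \<omega> x' y * f \<omega> x' y'"
  have "avg Q (\<lambda>\<omega>. avg Y (\<lambda>y. avg Y (\<lambda>y'. (avg X (\<lambda>x. f \<omega> x y * f \<omega> x y'))\<^sup>2)))
      = avg Q (\<lambda>\<omega>. avg Y (\<lambda>y. avg Y (\<lambda>y'. avg X (\<lambda>x. avg X (\<lambda>x'. ?h \<omega> x x' y y')))))"
    by (simp add: power2_eq_square avg_mult_avg mult.assoc)
  also have "\<dots> = avg Y (\<lambda>y. avg Y (\<lambda>y'. avg X (\<lambda>x. avg X (\<lambda>x'. avg Q (\<lambda>\<omega>. ?h \<omega> x x' y y')))))"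
    by (simp only: avg_swap[of Q])
  also have "\<dots> \<le> avg Y (\<lambda>y. avg Y (\<lambda>y'. avg X (\<lambda>x. avg X (\<lambda>x'. c + of_bool (x = x') + of_bool (y = y')))))"
  proof (intro avg_mono)
    fix y y' x x' assume a: "y \<in> Y" "y' \<in> Y" "x \<in> X" "x' \<in> X"
    have "avg Q (\<lambda>\<omega>. ?h \<omega> x x' y y') \<le> 1"
      using Q f01 by (intro avg_le_const mult_le_one mult_nonneg_nonneg) auto
    then show "avg Q (\<lambda>\<omega>. ?h \<omega> x x' y y') \<le> c + of_bool (x = x') + of_bool (y = y')"
      using cyc[OF a(3,4,1,2)] c by (cases "x = x'"; cases "y = y'") auto
  qed
  also have "\<dots> = c + 1 / card X + 1 / card Y"
  proof -
    show ?thesis using X Y by (simp add: avg_add avg_const avg_diagonal)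
  qed
  finally have C: "avg Q (\<lambda>\<omega>. avg Y (\<lambda>y. avg Y (\<lambda>y'. (avg X (\<lambda>x. f \<omega> x y * f \<omega> x y'))\<^sup>2)))
      \<le> c + 1 / card X + 1 / card Y" .
  have "d \<le> avg X (\<lambda>x. avg Y (\<lambda>y. avg Q (\<lambda>\<omega>. f \<omega> x y)))"
    by (intro avg_ge_const[OF X] avg_ge_const[OF Y] den)
  then have D: "d \<le> avg Q (\<lambda>\<omega>. avg X (\<lambda>x. avg Y (f \<omega> x)))"
    by (simp only: avg_swap[of Q])
  have "4 * p ^ 3 * d \<le> 4 * p ^ 3 * avg Q (\<lambda>\<omega>. avg X (\<lambda>x. avg Y (f \<omega> x)))"
    using D p by (intro mult_left_mono) auto
  then show ?thesis
    using C Q by (simp add: avg_add avg_diff avg_cmult avg_const)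
qed

section \<open>From quasirandom pairs of blocks to a clique\<close>

text \<open>\<open>s\<^sup>2\<close> is the defect allowed for a pair of blocks. By
  \<open>small\<close>, the total mean defect stays below \<open>s\<^sup>2\<close> times a lower
  bound for the probability that the erased graph lies in \<open>A\<close>; \<open>ks\<close> is the
  numerical condition of \<open>greedy_clique\<close>.\<close>

lemma (in interval_sample) exists_clique:
  assumes qkm: "q = k * m" and m: "0 < m"
    and qr: "quasirandom \<theta> n A" and \<theta>: "0 < \<theta>"
    and \<delta>: "0 < \<delta>" "\<delta> \<le> 1" "\<delta> \<le> mu n A" and s: "0 < s" "s \<le> 1"
    and ks: "k * (12 * s / (\<delta> ^ 4 * ((\<delta> / 2) ^ k)\<^sup>2)) < (\<delta> / 2) ^ k"
    and small: "k\<^sup>2 * (5 * \<eta> + 4 * sqrt (2 / L) + \<theta> + \<theta> * real (n choose 4) / L ^ 4 + 2 / m)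
       < s\<^sup>2 * (\<delta> - \<eta>)"
  shows "\<exists>K W. K \<subseteq> {1..n} \<and> card K = k \<and> W \<subseteq> E - pairs K \<and> W \<in> A \<and> (\<forall>e \<in> pairs K. insert e W \<in> A)"
proof -
  define p where "p = mu n A"
  \<comment> \<open>Blocks of positions, not of vertices. They are consecutive, so a smaller block
    index means smaller positions and hence smaller vertices.\<close>
  define B where "B a = {a * m..<a * m + m}" for a
  have B: "finite (B a)" "B a \<noteq> {}" "card (B a) = m" for a using m by (auto simp: B_def)
  have Bq: "u < q" if "a < k" "u \<in> B a" for a u
  proof -
    have "a * m + m \<le> k * m" using mult_le_mono1[of "Suc a" k m] that by simp
    then show ?thesis using that qkm by (simp add: B_def)
  qed
  have Bless: "u < v" if "a < b" "u \<in> B a" "v \<in> B b" for a b u v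
  proof -
    have "a * m + m \<le> b * m" using mult_le_mono1[of "Suc a" b m] that by simp
    then show ?thesis using that by (simp add: B_def)
  qed
  have p: "0 < p" "p \<le> 1" "\<delta> \<le> p"
  proof -
    show "\<delta> \<le> p" using \<delta> by (simp add: p_def)
    then show "0 < p" using \<delta> by linarith
    show "p \<le> 1" unfolding p_def mu_eq_avg by (rule avg_le_const) auto
  qed
  define \<Phi> where "\<Phi> \<omega> a b = avg (B b) (\<lambda>y. avg (B b) (\<lambda>y'. (avg (B a) (\<lambda>x. link A \<omega> x y * link A \<omega> x y'))\<^sup>2))
           - 4 * p ^ 3 * avg (B a) (\<lambda>x. avg (B b) (link A \<omega> x)) + 3 * p ^ 4" for \<omega> a b
  let ?O = "\<Omega> \<times> Pow E"
  let ?D = "{(a, b). a < b \<and> b < k}"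
  have finO: "finite ?O" "?O \<noteq> {}" using finite_\<Omega> \<Omega>_nonempty by (simp_all add: Sigma_empty_iff Pow_not_empty)
  \<comment> \<open>One \<open>\<eta>\<close> comes from the cycles and
    \<open>4 * (\<eta> + sqrt (2 / L))\<close> from the linear term with
    \<open>p ^ 3 \<le> 1\<close>; \<open>2 / m\<close> pays for degenerate walks. The multiples of
    \<open>p ^ 4\<close> cancel.\<close>
  define \<epsilon> where "\<epsilon> = 5 * \<eta> + 4 * sqrt (2 / L) + \<theta> + \<theta> * real (n choose 4) / L ^ 4 + 2 / m"
  have \<eta>0: "0 \<le> \<eta>" by (simp add: \<eta>_def)
  have \<epsilon>0: "0 \<le> \<epsilon>" unfolding \<epsilon>_def using \<eta>0 \<theta> by (intro add_nonneg_nonneg) auto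
  have \<Phi>0: "0 \<le> \<Phi> \<omega> a b" for \<omega> a b
    unfolding \<Phi>_def by (rule C4_defect_nonneg) (use B in auto)
  have avg_\<Phi>: "avg ?O (\<lambda>\<omega>. \<Phi> \<omega> a b) \<le> \<epsilon>" if ab: "a < b" "b < k" for a b
  proof -
    let ?c = "p ^ 4 + \<theta> + \<eta> + \<theta> * real (n choose 4) / L ^ 4"
    have cyc: "avg ?O (\<lambda>\<omega>. link A \<omega> x y * link A \<omega> x y' * link A \<omega> x' y * link A \<omega> x' y') \<le> ?c"
      if "x \<in> B a" "x' \<in> B a" "y \<in> B b" "y' \<in> B b" "x \<noteq> x'" "y \<noteq> y'" for x x' y y'
    proof -
      \<comment> \<open>\<open>avg_link_cycle\<close> wants increasing positions. The product is
        invariant under exchanging \<open>x\<close> with \<open>x'\<close> or \<open>y\<close> with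
        \<open>y'\<close>, which reduces the other orders to this one.\<close>
      have main: "avg ?O (\<lambda>\<omega>. link A \<omega> x y * link A \<omega> x y' * link A \<omega> x' y * link A \<omega> x' y') \<le> ?c"
        if "x \<in> B a" "x' \<in> B a" "y \<in> B b" "y' \<in> B b" "x < x'" "y < y'" for x x' y y'
        unfolding p_def using that Bless[OF ab(1)] Bq[OF ab(2)] by (intro avg_link_cycle[OF qr \<theta>]) auto
      show ?thesis
        using that main[of x x' y y'] main[of x' x y y'] main[of x x' y' y] main[of x' x y' y]
        by (cases x x' rule: linorder_cases; cases y y' rule: linorder_cases) (simp_all add: mult_ac)
    qed
    have "avg ?O (\<lambda>\<omega>. \<Phi> \<omega> a b)
        \<le> ?c + 1 / card (B a) + 1 / card (B b) - 4 * p ^ 3 * (p - \<eta> - sqrt (2 / L)) + 3 * p ^ 4"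
      unfolding \<Phi>_def
    proof (rule avg_C4_defect_le)
      show "p - \<eta> - sqrt (2 / L) \<le> avg ?O (\<lambda>\<omega>. link A \<omega> x y)" if "x \<in> B a" "y \<in> B b" for x y
        unfolding p_def using that Bless[OF ab(1)] Bq[OF ab(2)] by (intro avg_link) auto
      show "0 \<le> ?c" using p \<theta> \<eta>0 by (intro add_nonneg_nonneg) auto
    qed (use finO B p cyc in \<open>auto simp: link_def\<close>)
    also have "\<dots> = \<theta> + \<eta> + \<theta> * real (n choose 4) / L ^ 4 + 2 / m + 4 * (p ^ 3 * (\<eta> + sqrt (2 / L)))"
      by (simp add: B algebra_simps power_eq_if)
    also have "\<dots> \<le> \<theta> + \<eta> + \<theta> * real (n choose 4) / L ^ 4 + 2 / m + 4 * (1 * (\<eta> + sqrt (2 / L)))"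
      using p \<eta>0 by (intro add_left_mono mult_left_mono mult_right_mono power_le_one) auto
    also have "\<dots> = \<epsilon>" by (simp add: \<epsilon>_def)
    finally show ?thesis .
  qed
  have D: "finite ?D" "card ?D \<le> k\<^sup>2"
  proof -
    have sub: "?D \<subseteq> {..<k} \<times> {..<k}" by auto
    then show "finite ?D" by (rule finite_subset) auto
    show "card ?D \<le> k\<^sup>2" using card_mono[OF _ sub] by (simp add: card_cartesian_product power2_eq_square)
  qed
  \<comment> \<open>Union bound and Markov at once: if the claim failed, the sum of all
    \<open>\<Phi>\<close> would dominate \<open>s\<^sup>2\<close> times the indicator of the event,
    and averaging would contradict \<open>small\<close>.\<close>
  have "\<exists>\<omega>\<in>?O. erased (fst \<omega>) (snd \<omega>) \<in> A \<and> (\<forall>a b. a < b \<longrightarrow> b < k \<longrightarrow> \<Phi> \<omega> a b \<le> s\<^sup>2)"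
  proof (rule ccontr)
    assume none: "\<not> ?thesis"
    have "s\<^sup>2 * (\<delta> - \<eta>) \<le> s\<^sup>2 * avg ?O (\<lambda>\<omega>. of_bool (erased (fst \<omega>) (snd \<omega>) \<in> A))"
      using avg_erased_mem[of A] \<delta> by (intro mult_left_mono) auto
    also have "\<dots> = avg ?O (\<lambda>\<omega>. s\<^sup>2 * of_bool (erased (fst \<omega>) (snd \<omega>) \<in> A))"
      by (simp add: avg_cmult)
    also have "\<dots> \<le> avg ?O (\<lambda>\<omega>. \<Sum>(a, b)\<in>?D. \<Phi> \<omega> a b)"
    proof (rule avg_mono)
      fix \<omega> assume \<omega>: "\<omega> \<in> ?O"
      have nn: "0 \<le> (\<Sum>(a, b)\<in>?D. \<Phi> \<omega> a b)" by (rule sum_nonneg) (auto simp: \<Phi>0)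
      show "s\<^sup>2 * of_bool (erased (fst \<omega>) (snd \<omega>) \<in> A) \<le> (\<Sum>(a, b)\<in>?D. \<Phi> \<omega> a b)"
      proof (cases "erased (fst \<omega>) (snd \<omega>) \<in> A")
        case True
        then obtain a b where ab: "a < b" "b < k" "s\<^sup>2 < \<Phi> \<omega> a b" using none \<omega> by (meson not_less)
        have "\<Phi> \<omega> a b \<le> (\<Sum>(a, b)\<in>?D. \<Phi> \<omega> a b)"
          using member_le_sum[of "(a, b)" ?D "\<lambda>(a, b). \<Phi> \<omega> a b"] D(1) ab
          by (auto simp: \<Phi>0)
        then show ?thesis using ab True by simp
      qed (use nn in simp)
    qed
    also have "\<dots> = (\<Sum>(a, b)\<in>?D. avg ?O (\<lambda>\<omega>. \<Phi> \<omega> a b))"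
      by (simp add: case_prod_beta avg_sum)
    also have "\<dots> \<le> (\<Sum>_\<in>?D. \<epsilon>)"
      using avg_\<Phi> by (intro sum_mono) auto
    also have "\<dots> = card ?D * \<epsilon>" by simp
    also have "\<dots> \<le> real (k\<^sup>2) * \<epsilon>"
      using D(2) \<epsilon>0 by (intro mult_right_mono) (simp_all only: of_nat_le_iff)
    also have "\<dots> < s\<^sup>2 * (\<delta> - \<eta>)" using small by (simp add: \<epsilon>_def)
    finally show False by simp
  qed
  then obtain \<omega> where \<omega>: "\<omega> \<in> ?O" "erased (fst \<omega>) (snd \<omega>) \<in> A"
    "\<And>a b. a < b \<Longrightarrow> b < k \<Longrightarrow> \<Phi> \<omega> a b \<le> s\<^sup>2" by blast
  define x where "x = fst \<omega>"
  define W where "W = erased x (snd \<omega>)"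
  have x: "x \<in> \<Omega>" and WA: "W \<in> A" and WE: "W \<subseteq> E - pairs (x ` {..<q})"
    using \<omega> by (auto simp: x_def W_def erased_def)
  define G where "G u v \<longleftrightarrow> insert {x u, x v} W \<in> A" for u v
  have link: "link A \<omega> u v = of_bool (G u v)" for u v
    by (simp add: link_def G_def W_def x_def)
  let ?\<beta> = "\<delta> / 2"
  define C where "C = ?\<beta> ^ k"
  \<comment> \<open>\<open>few_low_degrees\<close> with \<open>\<kappa> = s\<^sup>2\<close> bounds
    \<open>(\<delta> * C)\<^sup>2 / 4\<close> times the number of low vertices by \<open>m\<close>
    times \<open>2 * s + s\<^sup>2 / p\<^sup>2\<close>, which is at most
    \<open>3 * s / \<delta>\<^sup>2\<close>. Solving for the number gives \<open>12\<close> and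
    \<open>\<delta> ^ 4\<close>.\<close>
  let ?\<tau> = "12 * s / (\<delta> ^ 4 * C\<^sup>2)"
  have c0: "0 < C" using \<delta> by (simp add: C_def)
  have low: "card {u \<in> B a. card {v \<in> Y. G u v} < ?\<beta> * card Y} \<le> ?\<tau> * m"
    if ab: "a < b" "b < k" and Y: "Y \<subseteq> B b" "C * m \<le> card Y" for a b Y
  proof -
    have fY: "finite Y" using Y(1) B(1) finite_subset by blast
    let ?L = "{u \<in> B a. (\<Sum>v\<in>Y. link A \<omega> u v) < p / 2 * card Y}"
    have "{u \<in> B a. card {v \<in> Y. G u v} < ?\<beta> * card Y} \<subseteq> ?L"
    proof
      fix u assume "u \<in> {u \<in> B a. card {v \<in> Y. G u v} < ?\<beta> * card Y}"
      then have u: "u \<in> B a" "card {v \<in> Y. G u v} < ?\<beta> * card Y" by blast+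
      have "(\<Sum>v\<in>Y. link A \<omega> u v) = card {v \<in> Y. G u v}"
        using fY by (simp add: link of_bool_def sum.If_cases Int_def)
      moreover have "?\<beta> * card Y \<le> p / 2 * card Y" using p by (intro mult_right_mono) auto
      ultimately have "(\<Sum>v\<in>Y. link A \<omega> u v) < p / 2 * card Y" using u(2) by linarith
      then show "u \<in> ?L" using u(1) by blast
    qed
    then have le: "real (card {u \<in> B a. card {v \<in> Y. G u v} < ?\<beta> * card Y}) \<le> card ?L"
      using B(1) by (simp add: card_mono)
    have cY: "\<delta> * C \<le> p * card Y / card (B b)"
    proof -
      have "C \<le> card Y / m" using Y(2) m by (simp add: pos_le_divide_eq)
      then have "\<delta> * C \<le> p * (card Y / m)" using p \<delta> c0 by (intro mult_mono) auto
      then show ?thesis by (simp add: B)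
    qed
    have "(\<delta> * C)\<^sup>2 / 4 * card ?L \<le> (p * card Y / card (B b))\<^sup>2 / 4 * card ?L"
      using cY \<delta> c0 by (intro mult_right_mono divide_right_mono power_mono) auto
    also have "\<dots> \<le> (2 * sqrt (s\<^sup>2) + s\<^sup>2 / p\<^sup>2) * card (B a)"
      using \<omega>(3)[OF ab] B p Y(1) unfolding \<Phi>_def by (intro few_low_degrees) auto
    also have "\<dots> = (2 * s + s\<^sup>2 / p\<^sup>2) * m" using s by (simp add: B)
    also have "\<dots> \<le> (2 * (s / \<delta>\<^sup>2) + s / \<delta>\<^sup>2) * m"
    proof (intro mult_right_mono add_mono mult_left_mono)
      have "\<delta>\<^sup>2 \<le> 1" using \<delta> by (simp add: power_le_one)
      then show "s \<le> s / \<delta>\<^sup>2" using s \<delta> by (simp add: pos_le_divide_eq mult_left_le)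
      have "s\<^sup>2 \<le> s" using s by (simp add: power2_eq_square mult_left_le)
      then show "s\<^sup>2 / p\<^sup>2 \<le> s / \<delta>\<^sup>2" using p \<delta> s by (intro frac_le power_mono) auto
    qed auto
    finally have fin: "(\<delta> * C)\<^sup>2 / 4 * card ?L \<le> (2 * (s / \<delta>\<^sup>2) + s / \<delta>\<^sup>2) * m"
      .
    have "card ?L * (\<delta> ^ 4 * C\<^sup>2) = (\<delta> * C)\<^sup>2 / 4 * card ?L * (4 * \<delta>\<^sup>2)"
      by (simp add: power4_eq_xxxx power2_eq_square mult_ac)
    also have "\<dots> \<le> (2 * (s / \<delta>\<^sup>2) + s / \<delta>\<^sup>2) * m * (4 * \<delta>\<^sup>2)"
      using fin by (rule mult_right_mono) simp
    also have "\<dots> = 12 * s * m" using \<delta> by (simp add: field_simps)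
    finally have "card ?L \<le> 12 * s * m / (\<delta> ^ 4 * C\<^sup>2)"
      using \<delta> c0 by (subst pos_le_divide_eq) auto
    then have "card ?L \<le> ?\<tau> * m" by simp
    then show ?thesis using le by linarith
  qed
  have "\<exists>y. (\<forall>b. 0 \<le> b \<and> b < k \<longrightarrow> y b \<in> B b) \<and> (\<forall>b c. 0 \<le> b \<and> b < c \<and> c < k \<longrightarrow> G (y b) (y c))"
  proof (rule greedy_clique[where V = B and \<beta> = ?\<beta> and \<tau> = ?\<tau> and m = m])
    show "k * ?\<tau> < ?\<beta> ^ k" using ks unfolding C_def .
    show "card {u \<in> B a. card {v \<in> Y. G u v} < ?\<beta> * card Y} \<le> ?\<tau> * m"
      if "a < b" "b < k" "Y \<subseteq> B b" "?\<beta> ^ k * m \<le> card Y" for a b Y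
      using low[OF that(1-3)] that(4) unfolding C_def by blast
  qed (use B \<delta> m in auto)
  then obtain y where y': "(\<forall>b. 0 \<le> b \<and> b < k \<longrightarrow> y b \<in> B b) \<and> (\<forall>b c. 0 \<le> b \<and> b < c \<and> c < k \<longrightarrow> G (y b) (y c))" ..
  have y: "b < k \<Longrightarrow> y b \<in> B b" "b < c \<Longrightarrow> c < k \<Longrightarrow> G (y b) (y c)" for b c
    using y' by simp_all
  let ?z = "\<lambda>b. x (y b)"
  let ?K = "?z ` {..<k}"
  have z_less: "?z b < ?z c" if "b < c" "c < k" for b c
    using that \<Omega>_less[OF x Bless[OF that(1) y(1) y(1)] Bq[OF that(2) y(1)]] by simp
  have "inj_on ?z {..<k}"
    by (rule linorder_inj_onI) (use z_less in \<open>force simp: less_imp_neq\<close>)+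
  then have "card ?K = k" by (simp add: card_image)
  moreover have Kq: "?K \<subseteq> x ` {..<q}" using y(1) Bq by blast
  moreover have "?K \<subseteq> {1..n}" using Kq \<Omega>_image_subset[OF x, of "{..<q}"] by blast
  moreover have "W \<subseteq> E - pairs ?K" using WE pairs_mono[OF Kq] by blast
  moreover have "insert e W \<in> A" if "e \<in> pairs ?K" for e
  proof -
    obtain b c where bc: "b < k" "c < k" "b \<noteq> c" "e = {?z b, ?z c}"
    proof -
      obtain u v where "u \<in> ?K" "v \<in> ?K" "u \<noteq> v" "e = {u, v}"
        using \<open>e \<in> pairs ?K\<close> unfolding mem_pairs_iff by blast
      then show thesis using that by blast
    qed
    then show ?thesis
      using y(2)[of b c] y(2)[of c b] by (cases b c rule: linorder_cases) (auto simp: G_def insert_commute)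
  qed
  ultimately show ?thesis
    using WA by (intro exI[of _ ?K] exI[of _ W] conjI ballI)
qed

section \<open>Choice of the constants and conclusion\<close>

theorem theorem1p8:
  fixes \<delta> :: real and k :: nat
  assumes "0 < \<delta>" and "\<delta> \<le> 1" and "k \<ge> 2"
  shows "\<exists>\<theta> > 0. \<exists>q0 :: nat. q0 \<ge> k \<and>
    (\<forall>n :: nat. \<forall>\<A> :: nat set set set.
       n \<ge> q0 \<longrightarrow> \<A> \<subseteq> Pow (edges n) \<longrightarrow> quasirandom \<theta> n \<A> \<longrightarrow> mu n \<A> \<ge> \<delta> \<longrightarrow>
       (\<exists>K W. K \<subseteq> {1..n} \<and> card K = k \<and> W \<subseteq> edges n - pairs K \<and>
              W \<in> \<A> \<and> (\<forall>e \<in> pairs K. insert e W \<in> \<A>))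
       \<and> (\<exists>G H X. G \<in> \<A> \<and> H \<in> \<A> \<and> H \<subseteq> G \<and> X \<subseteq> {1..n} \<and> card X \<ge> 2 \<and>
              G - H = pairs X))"
proof -
  \<comment> \<open>\<open>c\<close> is the least relative size of a candidate set, and
    \<open>s\<close> makes the left side of \<open>ks\<close> equal to \<open>c / 2\<close>. The
    unit of error \<open>\<beta>\<close> satisfies
    \<open>k\<^sup>2 * (16 * \<beta>) = s\<^sup>2 * (\<delta> / 2)\<close>, which leaves room for a
    total error of \<open>11 * \<beta>\<close>.\<close>
  define c where "c = (\<delta> / 2) ^ k"
  define s where "s = c ^ 3 * \<delta> ^ 4 / (24 * k)"
  define \<beta> where "\<beta> = s\<^sup>2 * \<delta> / (32 * k\<^sup>2)"
  have c: "0 < c" "c \<le> 1" using assms by (auto simp: c_def power_le_one)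
  have s: "0 < s" "s \<le> 1"
  proof -
    show "0 < s" using c assms by (simp add: s_def)
    have "c ^ 3 * \<delta> ^ 4 \<le> 1 * 1" using c assms by (intro mult_mono power_le_one) auto
    moreover have "1 \<le> 24 * real k" using assms by simp
    ultimately show "s \<le> 1" unfolding s_def using assms by (simp add: divide_le_eq)
  qed
  have \<beta>: "0 < \<beta>" "\<beta> \<le> \<delta> / 2"
  proof -
    show "0 < \<beta>" using s assms by (simp add: \<beta>_def)
    have "s\<^sup>2 * \<delta> \<le> 1 * \<delta>" using s assms by (intro mult_right_mono power_le_one) auto
    moreover have "2 \<le> 32 * (real k)\<^sup>2"
      using assms one_le_power[of "real k" 2] by linarith
    ultimately have "s\<^sup>2 * \<delta> / (32 * (real k)\<^sup>2) \<le> \<delta> / 2" using assms by (intro frac_le) auto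
    then show "\<beta> \<le> \<delta> / 2" by (simp add: \<beta>_def)
  qed
  have ks: "k * (12 * s / (\<delta> ^ 4 * c\<^sup>2)) < c"
  proof -
    have half: "k * (12 * s / (\<delta> ^ 4 * c\<^sup>2)) = c / 2"
      using assms c by (simp add: s_def field_simps power2_eq_square power3_eq_cube)
    show ?thesis unfolding half using c by simp
  qed
  obtain m :: nat where m: "2 / \<beta> < m" using reals_Archimedean2 by blast
  have m0: "0 < m" using m \<beta> by (cases m) (auto simp: field_simps)
  have m2: "2 / m \<le> \<beta>" using m m0 \<beta> by (simp add: field_simps)
  define q where "q = k * m"
  have q: "0 < q" "k \<le> q" using assms m0 by (auto simp: q_def)
  \<comment> \<open>Since \<open>n \<le> 2 * q * L\<close> below,
    \<open>(n choose 4) / L ^ 4\<close> is at most \<open>(2 * q) ^ 4\<close>. The denominator makes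
    the two errors caused by \<open>\<theta>\<close> add up to at most
    \<open>\<beta>\<close>.\<close>
  define \<theta> where "\<theta> = \<beta> / (1 + (2 * real q) ^ 4)"
  have \<theta>: "0 < \<theta>" "\<theta> + \<theta> * (2 * real q) ^ 4 = \<beta>"
  proof -
    have pos: "0 < 1 + (2 * real q) ^ 4" by (intro add_pos_nonneg) auto
    then show "0 < \<theta>" using \<beta> by (simp add: \<theta>_def)
    have "\<theta> + \<theta> * (2 * real q) ^ 4 = \<theta> * (1 + (2 * real q) ^ 4)" by (simp only: distrib_left mult_1_right)
    also have "\<dots> = \<beta>" unfolding \<theta>_def using pos by (intro nonzero_eq_divide_eq[THEN iffD1]) auto
    finally show "\<theta> + \<theta> * (2 * real q) ^ 4 = \<beta>" .
  qed
  \<comment> \<open>Serves \<open>\<eta> \<le> \<beta>\<close>, as the square of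
    \<open>\<eta>\<close> is \<open>q ^ 2 * 2 ^ q / L\<close>. The bound
    \<open>n \<ge> q * (L0 + 1)\<close> forces \<open>n div q\<close> above
    \<open>L0\<close>.\<close>
  obtain L0 :: nat where L0: "real q ^ 2 * 2 ^ q / \<beta>\<^sup>2 < L0" using reals_Archimedean2 by blast
  have "(\<exists>K W. K \<subseteq> {1..n} \<and> card K = k \<and> W \<subseteq> edges n - pairs K \<and>
              W \<in> \<A> \<and> (\<forall>e \<in> pairs K. insert e W \<in> \<A>))
       \<and> (\<exists>G H X. G \<in> \<A> \<and> H \<in> \<A> \<and> H \<subseteq> G \<and> X \<subseteq> {1..n} \<and> card X \<ge> 2 \<and> G - H = pairs X)"
    if n: "n \<ge> q * (L0 + 1)" and \<A>: "\<A> \<subseteq> Pow (edges n)" "quasirandom \<theta> n \<A>" "mu n \<A> \<ge> \<delta>" for n \<A>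
  proof -
    define L where "L = n div q"
    have LL: "L0 < L"
      using n q by (simp add: L_def less_eq_div_iff_mult_less_eq mult.commute Suc_le_eq[symmetric])
    interpret interval_sample n q L
      by unfold_locales (use q LL in \<open>auto simp: L_def\<close>)
    have n_le: "n \<le> 2 * q * L"
    proof -
      have "n < q * L + q"
        unfolding L_def using mult_div_mod_eq[of q n] mod_less_divisor[OF q(1), of n] by linarith
      moreover have "q \<le> q * L" using LL by simp
      ultimately show ?thesis unfolding mult.assoc by linarith
    qed
    have "\<eta> \<le> \<beta>"
    proof -
      have "\<eta> = sqrt (real q ^ 2 * 2 ^ q / L)"
        by (simp add: \<eta>_def real_sqrt_mult real_sqrt_divide)
      also have "\<dots> \<le> sqrt (\<beta>\<^sup>2)"
      proof (rule real_sqrt_le_mono)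
        have "real q ^ 2 * 2 ^ q / \<beta>\<^sup>2 \<le> L" using L0 LL by linarith
        then show "real q ^ 2 * 2 ^ q / L \<le> \<beta>\<^sup>2" using \<beta> L_pos by (simp add: field_simps)
      qed
      finally show ?thesis using \<beta> by simp
    qed
    moreover have "sqrt (2 / L) \<le> \<eta>"
    proof -
      have "2 ^ 1 \<le> (2 ^ q :: real)" using q by (intro power_increasing) auto
      then have "sqrt (2 / L) \<le> sqrt (2 ^ q / L)" by (simp add: divide_right_mono)
      also have "\<dots> \<le> q * sqrt (2 ^ q / L)"
        using q mult_right_mono[of 1 "real q" "sqrt (2 ^ q / L)"] by simp
      finally show ?thesis by (simp add: \<eta>_def)
    qed
    moreover have "\<theta> * real (n choose 4) / L ^ 4 \<le> \<theta> * (2 * real q) ^ 4"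
    proof -
      have "real (n choose 4) \<le> real n ^ 4"
        using binomial_le_pow[of 4 n]
        by (cases "4 \<le> n") (simp_all add: binomial_eq_0 del: of_nat_power flip: of_nat_power)
      also have "\<dots> \<le> (real (2 * q * L)) ^ 4"
        using n_le by (intro power_mono) (simp_all only: of_nat_le_iff of_nat_0_le_iff)
      also have "\<dots> = (2 * real q) ^ 4 * L ^ 4" by (simp add: power_mult_distrib)
      finally have "real (n choose 4) / L ^ 4 \<le> (2 * real q) ^ 4" using L_pos by (simp add: divide_le_eq)
      then show ?thesis using mult_left_mono[of _ _ \<theta>] \<theta> by fastforce
    qed
    \<comment> \<open>Nine \<open>\<beta>\<close> come from \<open>\<eta>\<close> and
      \<open>sqrt (2 / L) \<le> \<eta>\<close>, one from the two terms with \<open>\<theta>\<close>,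
      and one from \<open>2 / m\<close>.\<close>
    ultimately have "5 * \<eta> + 4 * sqrt (2 / L) + \<theta> + \<theta> * real (n choose 4) / L ^ 4 + 2 / m \<le> 11 * \<beta>"
      and \<eta>: "\<eta> \<le> \<delta> / 2"
      using \<theta> m2 \<beta> by linarith+
    then have "k\<^sup>2 * (5 * \<eta> + 4 * sqrt (2 / L) + \<theta> + \<theta> * real (n choose 4) / L ^ 4 + 2 / m) \<le> k\<^sup>2 * (11 * \<beta>)"
      by (intro mult_left_mono) auto
    also have "\<dots> < k\<^sup>2 * (16 * \<beta>)" using \<beta> assms by simp
    also have "\<dots> = s\<^sup>2 * (\<delta> / 2)" using assms by (simp add: \<beta>_def)
    also have "\<dots> \<le> s\<^sup>2 * (\<delta> - \<eta>)" using \<eta> by (intro mult_left_mono) auto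
    finally have ex: "\<exists>K W. K \<subseteq> {1..n} \<and> card K = k \<and> W \<subseteq> edges n - pairs K \<and>
        W \<in> \<A> \<and> (\<forall>e \<in> pairs K. insert e W \<in> \<A>)"
      using assms m0 \<A> \<theta> s ks
      by (intro exists_clique[where \<theta> = \<theta> and \<delta> = \<delta> and s = s and m = m])
        (auto simp: q_def c_def)
    from ex obtain K W where K: "K \<subseteq> {1..n}" "card K = k" "W \<subseteq> edges n - pairs K" "W \<in> \<A>"
      "\<forall>e \<in> pairs K. insert e W \<in> \<A>" by blast
    \<comment> \<open>For the last claim any two-element \<open>X\<close> inside \<open>K\<close>
      serves: \<open>pairs X\<close> is the single edge \<open>X\<close>, by which
      \<open>insert X W\<close> exceeds \<open>W\<close>.\<close>
    obtain X where X: "X \<subseteq> K" "card X = 2"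
      using obtain_subset_with_card_n[of 2 K] K(2) assms(3) by auto
    have XK: "X \<in> pairs K" using X by (simp add: pairs_def)
    then have "X \<notin> W" using K(3) by blast
    moreover have "pairs X = {X}"
    proof -
      obtain u v where "X = {u, v}" "u \<noteq> v" using X(2) by (auto simp: card_2_iff)
      then show ?thesis by (simp add: pairs_insert)
    qed
    ultimately have diff: "insert X W - W = pairs X" by auto
    have "insert X W \<in> \<A>" "X \<subseteq> {1..n}" "2 \<le> card X" using K(1,5) X XK by auto
    then show ?thesis
      using diff K(4) by (intro conjI[OF ex] exI[of _ "insert X W"] exI[of _ W] exI[of _ X] conjI) auto
  qed
  moreover have "k \<le> q * (L0 + 1)" using q(2) by (simp add: add_increasing2)
  ultimately show ?thesis using \<theta>(1) by blast
qed

end
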